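(* The AMA-Dirac element $\mathcal{D}=\sum_{i<j}M_{ij}\otimes c_ic_j\in\mathsf{A}\otimes\mathcal{C}$ is independent of the choice of orthonormal basis $\{y_1,\dots,y_n\}$ of $E$ used to define it. In particular, it is $\rho(\tilde W)$-invariant, i.e. $\rho(\tilde w)\,\mathcal{D}\,\rho(\tilde w)^{-1}=\mathcal{D}$ for all $\tilde w\in\tilde W$.
   Context: Setting. $(E,B)$ is a Euclidean space of dimension $n$ affording the reflection representation of a finite (real) reflection group $W\subset\mathsf{O}(E,B)$. $R\subset E^*$ is the root system, $R^\vee\subset E$ the dual root system with $\langle\alpha,\alpha^\vee\rangle=2$, where $\langle-,-\rangle\colon E^*\times E\to\mathbb{R}$ is the natural pairing; $s_\alpha(y)=y-\langle\alpha,y\rangle\alpha^\vee$. A positive system $R_+$ is fixed, and $c\colon R_+\to\mathbb{C}$, $\alpha\mapsto c_\alpha$, is a $W$-invariant parameter function. Put $\mathfrak{h}=E_{\mathbb{C}}$, $\mathfrak{h}^*=E^*_{\mathbb{C}}$. Given an orthonormal basis $y_1,\dots,y_n$ of $E$, let $x_1,\dots,x_n$ be the dual basis of $E^*$ (i.e. $x_i=B(y_i,-)$). Rational Cherednik algebra $\mathsf{H}$: the quotient of the smash product $T(\mathfrak{h}^*\oplus\mathfrak{h})\#W$ by $[x,x']=0=[y,y']$ and $[y,x]=\langle x,y\rangle+\sum_{\alpha>0}c_\alpha\langle\alpha,y\rangle\langle x,\alpha^\vee\rangle s_\alpha$ for $x,x'\in\mathfrak{h}^*$, $y,y'\in\mathfrak{h}$.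 Dunkl angular momentum algebra $\mathsf{A}$: the associative subalgebra of $\mathsf{H}$ generated by $W$ and the elements $M_{ij}=x_iy_j-x_jy_i$, $1\le i<j\le n$. Clifford algebra: $\mathcal{C}_{\mathbb{R}}$ is the real algebra generated by $E$ with relations $yy'+y'y=2B(y,y')$; $c_i\in\mathcal{C}_{\mathbb R}$ is the image of $y_i$, so $c_ic_j+c_jc_i=2\delta_{ij}$; $\mathcal{C}=\mathcal{C}_{\mathbb{R}}\otimes\mathbb{C}$. Let $\varepsilon$ be the automorphism of $\mathcal{C}_{\mathbb R}$ that is $-1$ on $E$, ${}^t$ the anti-automorphism that is the identity on $E$, and $\eta^*=\varepsilon(\eta^t)$. The group $\mathsf{Pin}$ consists of invertible $\eta\in\mathcal{C}_{\mathbb R}$ with $\varepsilon(\eta)y\eta^{-1}\in E$ for all $y\in E$ and $(\eta^*\eta)^2=1$; $p\colon\mathsf{Pin}\to\mathsf{O}(E,B)$, $p(\eta)y=\varepsilon(\eta)y\eta^{-1}$, is a double cover with kernel $\{\pm1\}$. $\tilde W=p^{-1}(W)$, and $\rho\colon\mathbb{C}\tilde W\to\mathsf{A}\otimes\mathcal{C}$ is the linear extension of $\rho(\tilde w)=p(\tilde w)\otimes\tilde w$, where $\tilde w$ in the second factor is viewed as an element of $\mathcal{C}$. *)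

theory Defs
  imports
    "HOL-Analysis.Analysis"
    "HOL-Algebra.QuotRing"
    "HOL-Algebra.Module"
    "HOL-Algebra.Subrings"
    "HOL-Algebra.Generated_Groups"
    "HOL-Library.Poly_Mapping"
begin

section \<open>Associative algebras over a field\<close>

text \<open>
  An associative unital algebra over a field (a type of class \<^class>\<open>field\<close>) is a record of type
  \<^type>\<open>module\<close>, i.e. a ring together with a scalar multiplication. (The locale of the same
  library theory called algebra is restricted to commutative rings and is not used.)
\<close>

definition algebra_hom :: "('k, 'x) module \<Rightarrow> ('k, 'y) module \<Rightarrow> ('x \<Rightarrow> 'y) set" where
  "algebra_hom A B =
     {f \<in> ring_hom A B. \<forall>z. \<forall>a\<in>carrier A. f (z \<odot>\<^bsub>A\<^esub> a) = z \<odot>\<^bsub>B\<^esub> f a}"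

definition opposite_algebra :: "('k, 'x) module \<Rightarrow> ('k, 'x) module" where
  "opposite_algebra A = A\<lparr>mult := \<lambda>a b. b \<otimes>\<^bsub>A\<^esub> a\<rparr>"

definition commutator :: "('k, 'x) module \<Rightarrow> 'x \<Rightarrow> 'x \<Rightarrow> 'x" where
  "commutator A a b = a \<otimes>\<^bsub>A\<^esub> b \<ominus>\<^bsub>A\<^esub> b \<otimes>\<^bsub>A\<^esub> a"

text \<open>The unital subalgebra generated by a set of elements.\<close>

definition generated_subalgebra :: "('k, 'x) module \<Rightarrow> 'x set \<Rightarrow> ('k, 'x) module" where
  "generated_subalgebra A S =
     A\<lparr>carrier := \<Inter>{T. subring T A \<and> (\<forall>z. \<forall>a\<in>T. z \<odot>\<^bsub>A\<^esub> a \<in> T) \<and> S \<subseteq> T}\<rparr>"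

text \<open>The quotient of \<open>A\<close> by the two-sided ideal generated by a set \<open>S\<close> of relators. Since \<open>A\<close> is
  unital, a ring ideal of \<open>A\<close> is automatically a linear subspace.\<close>

definition quotient_class :: "('k, 'x) module \<Rightarrow> 'x set \<Rightarrow> 'x \<Rightarrow> 'x set" where
  "quotient_class A S a = (Idl\<^bsub>A\<^esub> S) +>\<^bsub>A\<^esub> a"

definition quotient_algebra :: "('k, 'x) module \<Rightarrow> 'x set \<Rightarrow> ('k, 'x set) module" where
  "quotient_algebra A S =
     ring.extend (A Quot (Idl\<^bsub>A\<^esub> S))
       (module.fields (\<lambda>z K. \<Union>a\<in>K. quotient_class A S (z \<odot>\<^bsub>A\<^esub> a)))"

definition monoid_algebra :: "('g, 'm) monoid_scheme \<Rightarrow> ('k::field, 'g \<Rightarrow>\<^sub>0 'k) module" where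
  "monoid_algebra G =
     \<lparr>carrier = {f. Poly_Mapping.keys f \<subseteq> carrier G},
      mult = (\<lambda>f g. \<Sum>a\<in>Poly_Mapping.keys f. \<Sum>b\<in>Poly_Mapping.keys g.
                Poly_Mapping.single (a \<otimes>\<^bsub>G\<^esub> b)
                  (Poly_Mapping.lookup f a * Poly_Mapping.lookup g b)),
      one = Poly_Mapping.single \<one>\<^bsub>G\<^esub> 1,
      zero = 0,
      add = (+),
      smult = (\<lambda>z. Poly_Mapping.map ((*) z))\<rparr>"

text \<open>
  The tensor product of two algebras. As a vector space, the monoid algebra of the multiplicative
  monoid \<open>A \<times> B\<close> is the free vector space on the set \<open>A \<times> B\<close>, and its product is
  \<open>(a, b) (a', b') = (a a', b b')\<close>. The span of the bilinearity relators is stable under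
  multiplication by basis elements, hence it is the ideal which they generate.
\<close>

definition bilinear_relators ::
  "('k::field, 'x) module \<Rightarrow> ('k, 'y) module \<Rightarrow> ('x \<times> 'y \<Rightarrow>\<^sub>0 'k) set" where
  "bilinear_relators A B =
     (let e = (\<lambda>a b. Poly_Mapping.single (a, b) 1);
          s = (\<lambda>z. Poly_Mapping.map ((*) z)) in
      {e (a \<oplus>\<^bsub>A\<^esub> a') b - e a b - e a' b | a a' b.
         a \<in> carrier A \<and> a' \<in> carrier A \<and> b \<in> carrier B} \<union>
      {e a (b \<oplus>\<^bsub>B\<^esub> b') - e a b - e a b' | a b b'.
         a \<in> carrier A \<and> b \<in> carrier B \<and> b' \<in> carrier B} \<union>
      {e (z \<odot>\<^bsub>A\<^esub> a) b - s z (e a b) | z a b. a \<in> carrier A \<and> b \<in> carrier B} \<union>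
      {e a (z \<odot>\<^bsub>B\<^esub> b) - s z (e a b) | z a b. a \<in> carrier A \<and> b \<in> carrier B})"

definition tensor_product ::
  "('k::field, 'x) module \<Rightarrow> ('k, 'y) module \<Rightarrow> ('k, ('x \<times> 'y \<Rightarrow>\<^sub>0 'k) set) module" where
  "tensor_product A B = quotient_algebra (monoid_algebra (A \<times>\<times> B)) (bilinear_relators A B)"

definition pure_tensor ::
  "('k::field, 'x) module \<Rightarrow> ('k, 'y) module \<Rightarrow> 'x \<Rightarrow> 'y \<Rightarrow> ('x \<times> 'y \<Rightarrow>\<^sub>0 'k) set" where
  "pure_tensor A B a b =
     quotient_class (monoid_algebra (A \<times>\<times> B)) (bilinear_relators A B)
       (Poly_Mapping.single (a, b) 1)"

text \<open>
  The tensor algebra of a vector space \<open>V\<close> with scalar multiplication \<open>sc\<close>: the free algebra on the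
  underlying set of \<open>V\<close>, modulo the relators making the inclusion of \<open>V\<close> linear.
\<close>

definition word_monoid :: "'v list monoid" where
  "word_monoid = \<lparr>carrier = UNIV, mult = (@), one = []\<rparr>"

definition linear_relators :: "('k::field \<Rightarrow> 'v::ab_group_add \<Rightarrow> 'v) \<Rightarrow> ('v list \<Rightarrow>\<^sub>0 'k) set" where
  "linear_relators sc =
     (let e = (\<lambda>v. Poly_Mapping.single [v] 1) in
      {e (v + v') - e v - e v' | v v'. True} \<union>
      {e (sc z v) - Poly_Mapping.map ((*) z) (e v) | z v. True})"

definition tensor_algebra ::
  "('k::field \<Rightarrow> 'v::ab_group_add \<Rightarrow> 'v) \<Rightarrow> ('k, ('v list \<Rightarrow>\<^sub>0 'k) set) module" where
  "tensor_algebra sc = quotient_algebra (monoid_algebra word_monoid) (linear_relators sc)"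

definition tensor_gen ::
  "('k::field \<Rightarrow> 'v::ab_group_add \<Rightarrow> 'v) \<Rightarrow> 'v \<Rightarrow> ('v list \<Rightarrow>\<^sub>0 'k) set" where
  "tensor_gen sc v =
     quotient_class (monoid_algebra word_monoid) (linear_relators sc) (Poly_Mapping.single [v] 1)"

text \<open>
  The automorphism of the tensor algebra induced by a linear automorphism \<open>f\<close>: the induced
  automorphism of the free algebra preserves the ideal of relations, so it maps cosets to cosets.
\<close>

definition tensor_map :: "('v \<Rightarrow> 'v) \<Rightarrow> ('v list \<Rightarrow>\<^sub>0 'k::field) set \<Rightarrow> ('v list \<Rightarrow>\<^sub>0 'k) set" where
  "tensor_map f K =
     (\<lambda>p. \<Sum>l\<in>Poly_Mapping.keys p. Poly_Mapping.single (map f l) (Poly_Mapping.lookup p l)) ` K"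

text \<open>
  The smash product \<open>A # G\<close> of an algebra with a finite group \<open>G\<close> acting on it by automorphisms:
  the function \<open>f\<close> stands for \<open>\<Sum>w. f w # w\<close>, and \<open>(a # u) (b # v) = a (u b) # u v\<close>.
\<close>

definition smash_product ::
  "('k, 'x) module \<Rightarrow> ('g, 'm) monoid_scheme \<Rightarrow> ('g \<Rightarrow> 'x \<Rightarrow> 'x) \<Rightarrow> ('k, 'g \<Rightarrow> 'x) module" where
  "smash_product A G act =
     \<lparr>carrier = carrier G \<rightarrow>\<^sub>E carrier A,
      mult = (\<lambda>f g. \<lambda>w\<in>carrier G.
                \<Oplus>\<^bsub>A\<^esub>u\<in>carrier G. f u \<otimes>\<^bsub>A\<^esub> act u (g (inv\<^bsub>G\<^esub> u \<otimes>\<^bsub>G\<^esub> w))),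
      one = (\<lambda>w\<in>carrier G. if w = \<one>\<^bsub>G\<^esub> then \<one>\<^bsub>A\<^esub> else \<zero>\<^bsub>A\<^esub>),
      zero = (\<lambda>w\<in>carrier G. \<zero>\<^bsub>A\<^esub>),
      add = (\<lambda>f g. \<lambda>w\<in>carrier G. f w \<oplus>\<^bsub>A\<^esub> g w),
      smult = (\<lambda>z f. \<lambda>w\<in>carrier G. z \<odot>\<^bsub>A\<^esub> f w)\<rparr>"

text \<open>The element \<open>a # w\<close>.\<close>

definition smash_elem ::
  "('k, 'x) module \<Rightarrow> ('g, 'm) monoid_scheme \<Rightarrow> 'x \<Rightarrow> 'g \<Rightarrow> ('g \<Rightarrow> 'x)" where
  "smash_elem A G a w = (\<lambda>u\<in>carrier G. if u = w then a else \<zero>\<^bsub>A\<^esub>)"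


section \<open>Complexification\<close>

text \<open>The pair \<open>(a, b)\<close> stands for \<open>a + \<i> b\<close>.\<close>

definition complex_scale :: "complex \<Rightarrow> 'v::real_vector \<times> 'v \<Rightarrow> 'v \<times> 'v" where
  "complex_scale z = (\<lambda>(a, b). (Re z *\<^sub>R a - Im z *\<^sub>R b, Im z *\<^sub>R a + Re z *\<^sub>R b))"

definition complexified_algebra :: "(real, 'x) module \<Rightarrow> (complex, 'x \<times> 'x) module" where
  "complexified_algebra A =
     \<lparr>carrier = carrier A \<times> carrier A,
      mult = (\<lambda>(a, b) (a', b').
                (a \<otimes>\<^bsub>A\<^esub> a' \<ominus>\<^bsub>A\<^esub> b \<otimes>\<^bsub>A\<^esub> b', a \<otimes>\<^bsub>A\<^esub> b' \<oplus>\<^bsub>A\<^esub> b \<otimes>\<^bsub>A\<^esub> a')),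
      one = (\<one>\<^bsub>A\<^esub>, \<zero>\<^bsub>A\<^esub>),
      zero = (\<zero>\<^bsub>A\<^esub>, \<zero>\<^bsub>A\<^esub>),
      add = (\<lambda>(a, b) (a', b'). (a \<oplus>\<^bsub>A\<^esub> a', b \<oplus>\<^bsub>A\<^esub> b')),
      smult = (\<lambda>z (a, b). (Re z \<odot>\<^bsub>A\<^esub> a \<ominus>\<^bsub>A\<^esub> Im z \<odot>\<^bsub>A\<^esub> b, Im z \<odot>\<^bsub>A\<^esub> a \<oplus>\<^bsub>A\<^esub> Re z \<odot>\<^bsub>A\<^esub> b))\<rparr>"


section \<open>Reflection groups and root systems\<close>

text \<open>
  The Euclidean space \<open>(E, B)\<close> is a type \<open>'a\<close> of class \<^class>\<open>euclidean_space\<close> with its inner product,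
  and \<open>E\<^sup>*\<close> is the type of (automatically bounded) linear functionals on it.
\<close>

type_synonym 'a dual = "'a \<Rightarrow>\<^sub>L real"

definition orthogonal_group :: "('a::euclidean_space \<Rightarrow> 'a) monoid" where
  "orthogonal_group = \<lparr>carrier = {f. orthogonal_transformation f}, mult = (\<circ>), one = id\<rparr>"

text \<open>The coroot \<open>\<alpha>\<^sup>\<or> = 2 a / B(a, a)\<close>, where \<open>a\<close> (the value at 1 of the adjoint of \<open>\<alpha>\<close>) is the vector
  with \<open>\<alpha> = B(a, -)\<close>.\<close>

definition coroot :: "'a::euclidean_space dual \<Rightarrow> 'a" where
  "coroot \<alpha> = (let a = adjoint (blinfun_apply \<alpha>) 1 in (2 / (a \<bullet> a)) *\<^sub>R a)"

definition reflection :: "'a::euclidean_space dual \<Rightarrow> 'a \<Rightarrow> 'a" where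
  "reflection \<alpha> y = y - blinfun_apply \<alpha> y *\<^sub>R coroot \<alpha>"

text \<open>The contragredient action: \<open>\<langle>w x, y\<rangle> = \<langle>x, w\<^sup>-\<^sup>1 y\<rangle>\<close>.\<close>

definition dual_act :: "('a::euclidean_space \<Rightarrow> 'a) \<Rightarrow> 'a dual \<Rightarrow> 'a dual" where
  "dual_act w x = Blinfun (\<lambda>y. blinfun_apply x (inv_into UNIV w y))"

definition root_system :: "'a::euclidean_space dual set \<Rightarrow> bool" where
  "root_system R \<longleftrightarrow>
     finite R \<and> 0 \<notin> R \<and>
     (\<forall>\<alpha>\<in>R. \<forall>t. t *\<^sub>R \<alpha> \<in> R \<longleftrightarrow> t = 1 \<or> t = - 1) \<and>
     (\<forall>\<alpha>\<in>R. \<forall>\<beta>\<in>R. dual_act (reflection \<alpha>) \<beta> \<in> R)"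

definition reflection_group_with_roots ::
  "('a::euclidean_space \<Rightarrow> 'a) set \<Rightarrow> 'a dual set \<Rightarrow> bool" where
  "reflection_group_with_roots W R \<longleftrightarrow>
     root_system R \<and> finite W \<and> W = generate orthogonal_group (reflection ` R)"

definition positive_system :: "'a::euclidean_space dual set \<Rightarrow> 'a dual set \<Rightarrow> bool" where
  "positive_system R Rp \<longleftrightarrow>
     (\<exists>v. (\<forall>\<alpha>\<in>R. blinfun_apply \<alpha> v \<noteq> 0) \<and> Rp = {\<alpha> \<in> R. blinfun_apply \<alpha> v > 0})"

text \<open>Invariance for a function on \<open>R\<^sub>+\<close>, which \<open>W\<close> does not preserve: \<open>c\<close> is constant on
  \<open>W\<close>-orbits intersected with \<open>R\<^sub>+\<close>. As \<open>s\<^sub>\<alpha> \<alpha> = - \<alpha>\<close>, this amounts to \<open>W\<close>-invariance of the even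
  extension of \<open>c\<close> to \<open>R\<close>.\<close>

definition invariant_parameter ::
  "('a::euclidean_space \<Rightarrow> 'a) set \<Rightarrow> 'a dual set \<Rightarrow> ('a dual \<Rightarrow> complex) \<Rightarrow> bool" where
  "invariant_parameter W Rp c \<longleftrightarrow>
     (\<forall>w\<in>W. \<forall>\<alpha>\<in>Rp. dual_act w \<alpha> \<in> Rp \<longrightarrow> c (dual_act w \<alpha>) = c \<alpha>)"

definition weyl_group :: "('a::euclidean_space \<Rightarrow> 'a) set \<Rightarrow> ('a \<Rightarrow> 'a) monoid" where
  "weyl_group W = orthogonal_group\<lparr>carrier := W\<rparr>"

text \<open>Orthonormal bases \<open>y\<^sub>1, \<dots>, y\<^sub>n\<close> are indexed by \<open>{1..n}\<close>; the other values of \<open>y\<close> are irrelevant.\<close>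

definition orthonormal_basis :: "(nat \<Rightarrow> 'a::euclidean_space) \<Rightarrow> bool" where
  "orthonormal_basis y \<longleftrightarrow>
     (\<forall>i\<in>{1..DIM('a)}. \<forall>j\<in>{1..DIM('a)}. y i \<bullet> y j = (if i = j then 1 else 0)) \<and>
     span (y ` {1..DIM('a)}) = UNIV"


section \<open>The rational Cherednik algebra\<close>

type_synonym 'a cvec = "'a \<times> 'a"
type_synonym 'a cdual = "'a dual \<times> 'a dual"
type_synonym 'a hh = "'a cdual \<times> 'a cvec"
type_synonym 'a hh_tensor = "('a hh list \<Rightarrow>\<^sub>0 complex) set"
type_synonym 'a cherednik = "(('a \<Rightarrow> 'a) \<Rightarrow> 'a hh_tensor) set"

text \<open>The complex bilinear extension of the pairing between \<open>E\<^sup>*\<close> and \<open>E\<close>.\<close>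

definition cpairing :: "'a::euclidean_space cdual \<Rightarrow> 'a cvec \<Rightarrow> complex" where
  "cpairing = (\<lambda>(x, x') (y, y').
     Complex (blinfun_apply x y - blinfun_apply x' y') (blinfun_apply x y' + blinfun_apply x' y))"

definition hh_scale :: "complex \<Rightarrow> 'a::euclidean_space hh \<Rightarrow> 'a hh" where
  "hh_scale z = map_prod (complex_scale z) (complex_scale z)"

definition hh_act :: "('a::euclidean_space \<Rightarrow> 'a) \<Rightarrow> 'a hh \<Rightarrow> 'a hh" where
  "hh_act w = map_prod (map_prod (dual_act w) (dual_act w)) (map_prod w w)"

definition hh_smash ::
  "('a::euclidean_space \<Rightarrow> 'a) set \<Rightarrow> (complex, ('a \<Rightarrow> 'a) \<Rightarrow> 'a hh_tensor) module" where
  "hh_smash W =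
     smash_product (tensor_algebra hh_scale) (weyl_group W) (\<lambda>w. tensor_map (hh_act w))"

definition smash_x ::
  "('a::euclidean_space \<Rightarrow> 'a) set \<Rightarrow> 'a cdual \<Rightarrow> ('a \<Rightarrow> 'a) \<Rightarrow> 'a hh_tensor" where
  "smash_x W x = smash_elem (tensor_algebra hh_scale) (weyl_group W) (tensor_gen hh_scale (x, 0)) id"

definition smash_y ::
  "('a::euclidean_space \<Rightarrow> 'a) set \<Rightarrow> 'a cvec \<Rightarrow> ('a \<Rightarrow> 'a) \<Rightarrow> 'a hh_tensor" where
  "smash_y W y = smash_elem (tensor_algebra hh_scale) (weyl_group W) (tensor_gen hh_scale (0, y)) id"

definition smash_w ::
  "('a::euclidean_space \<Rightarrow> 'a) set \<Rightarrow> ('a \<Rightarrow> 'a) \<Rightarrow> ('a \<Rightarrow> 'a) \<Rightarrow> 'a hh_tensor" where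
  "smash_w W w = smash_elem (tensor_algebra hh_scale) (weyl_group W) \<one>\<^bsub>tensor_algebra hh_scale\<^esub> w"

definition cherednik_relators ::
  "('a::euclidean_space \<Rightarrow> 'a) set \<Rightarrow> 'a dual set \<Rightarrow> ('a dual \<Rightarrow> complex) \<Rightarrow>
     (('a \<Rightarrow> 'a) \<Rightarrow> 'a hh_tensor) set" where
  "cherednik_relators W Rp c =
     (let S = hh_smash W in
      {commutator S (smash_x W x) (smash_x W x') | x x'. True} \<union>
      {commutator S (smash_y W y) (smash_y W y') | y y'. True} \<union>
      {commutator S (smash_y W y) (smash_x W x) \<ominus>\<^bsub>S\<^esub>
         (cpairing x y \<odot>\<^bsub>S\<^esub> \<one>\<^bsub>S\<^esub> \<oplus>\<^bsub>S\<^esub>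
          (\<Oplus>\<^bsub>S\<^esub>\<alpha>\<in>Rp. (c \<alpha> * cpairing (\<alpha>, 0) y * cpairing x (coroot \<alpha>, 0))
             \<odot>\<^bsub>S\<^esub> smash_w W (reflection \<alpha>))) | x y. True})"

definition cherednik_algebra ::
  "('a::euclidean_space \<Rightarrow> 'a) set \<Rightarrow> 'a dual set \<Rightarrow> ('a dual \<Rightarrow> complex) \<Rightarrow>
     (complex, 'a cherednik) module" where
  "cherednik_algebra W Rp c = quotient_algebra (hh_smash W) (cherednik_relators W Rp c)"

definition cherednik_x ::
  "('a::euclidean_space \<Rightarrow> 'a) set \<Rightarrow> 'a dual set \<Rightarrow> ('a dual \<Rightarrow> complex) \<Rightarrow> 'a cdual \<Rightarrow> 'a cherednik"
  where "cherednik_x W Rp c x =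
     quotient_class (hh_smash W) (cherednik_relators W Rp c) (smash_x W x)"

definition cherednik_y ::
  "('a::euclidean_space \<Rightarrow> 'a) set \<Rightarrow> 'a dual set \<Rightarrow> ('a dual \<Rightarrow> complex) \<Rightarrow> 'a cvec \<Rightarrow> 'a cherednik"
  where "cherednik_y W Rp c y =
     quotient_class (hh_smash W) (cherednik_relators W Rp c) (smash_y W y)"

definition cherednik_w ::
  "('a::euclidean_space \<Rightarrow> 'a) set \<Rightarrow> 'a dual set \<Rightarrow> ('a dual \<Rightarrow> complex) \<Rightarrow> ('a \<Rightarrow> 'a) \<Rightarrow> 'a cherednik"
  where "cherednik_w W Rp c w =
     quotient_class (hh_smash W) (cherednik_relators W Rp c) (smash_w W w)"


section \<open>The Dunkl angular momentum algebra\<close>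

text \<open>\<open>M\<^sub>i\<^sub>j = x\<^sub>i y\<^sub>j - x\<^sub>j y\<^sub>i\<close> where \<open>x\<^sub>i = B(y\<^sub>i, -)\<close>.\<close>

definition angular_momentum ::
  "('a::euclidean_space \<Rightarrow> 'a) set \<Rightarrow> 'a dual set \<Rightarrow> ('a dual \<Rightarrow> complex) \<Rightarrow>
     (nat \<Rightarrow> 'a) \<Rightarrow> nat \<Rightarrow> nat \<Rightarrow> 'a cherednik" where
  "angular_momentum W Rp c y i j =
     (let H = cherednik_algebra W Rp c;
          mx = (\<lambda>i. cherednik_x W Rp c (blinfun_inner_right (y i), 0));
          my = (\<lambda>i. cherednik_y W Rp c (y i, 0))
      in mx i \<otimes>\<^bsub>H\<^esub> my j \<ominus>\<^bsub>H\<^esub> mx j \<otimes>\<^bsub>H\<^esub> my i)"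

definition index_pairs :: "nat \<Rightarrow> (nat \<times> nat) set" where
  "index_pairs n = {(i, j). 1 \<le> i \<and> i < j \<and> j \<le> n}"

definition angular_momentum_algebra ::
  "('a::euclidean_space \<Rightarrow> 'a) set \<Rightarrow> 'a dual set \<Rightarrow> ('a dual \<Rightarrow> complex) \<Rightarrow>
     (nat \<Rightarrow> 'a) \<Rightarrow> (complex, 'a cherednik) module" where
  "angular_momentum_algebra W Rp c y =
     generated_subalgebra (cherednik_algebra W Rp c)
       (cherednik_w W Rp c ` W \<union>
        (\<lambda>(i, j). angular_momentum W Rp c y i j) ` index_pairs DIM('a))"


section \<open>The Clifford algebra and the Pin cover\<close>

type_synonym 'a clifford = "('a list \<Rightarrow>\<^sub>0 real) set set"

definition clifford_relators :: "('a::euclidean_space list \<Rightarrow>\<^sub>0 real) set set" where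
  "clifford_relators =
     (let T = tensor_algebra scaleR; e = tensor_gen scaleR in
      {e y \<otimes>\<^bsub>T\<^esub> e y' \<oplus>\<^bsub>T\<^esub> e y' \<otimes>\<^bsub>T\<^esub> e y \<ominus>\<^bsub>T\<^esub> (2 * (y \<bullet> y')) \<odot>\<^bsub>T\<^esub> \<one>\<^bsub>T\<^esub> | y y'. True})"

definition real_clifford :: "(real, 'a::euclidean_space clifford) module" where
  "real_clifford = quotient_algebra (tensor_algebra scaleR) clifford_relators"

definition clifford_vec :: "'a::euclidean_space \<Rightarrow> 'a clifford" where
  "clifford_vec y = quotient_class (tensor_algebra scaleR) clifford_relators (tensor_gen scaleR y)"

definition clifford :: "(complex, 'a::euclidean_space clifford \<times> 'a clifford) module" where
  "clifford = complexified_algebra real_clifford"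

definition clifford_of_real :: "'a::euclidean_space clifford \<Rightarrow> 'a clifford \<times> 'a clifford" where
  "clifford_of_real \<eta> = (\<eta>, \<zero>\<^bsub>real_clifford\<^esub>)"

text \<open>The vectors generate the Clifford algebra, so the choices in the next two definitions are unique
  on its carrier.\<close>

definition clifford_eps :: "'a::euclidean_space clifford \<Rightarrow> 'a clifford" where
  "clifford_eps =
     (SOME f. f \<in> algebra_hom real_clifford real_clifford \<and>
        bij_betw f (carrier real_clifford) (carrier real_clifford) \<and>
        (\<forall>y. f (clifford_vec y) = \<ominus>\<^bsub>real_clifford\<^esub> clifford_vec y))"

definition clifford_transpose :: "'a::euclidean_space clifford \<Rightarrow> 'a clifford" where
  "clifford_transpose =
     (SOME f. f \<in> algebra_hom real_clifford (opposite_algebra real_clifford) \<and>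
        bij_betw f (carrier real_clifford) (carrier real_clifford) \<and>
        (\<forall>y. f (clifford_vec y) = clifford_vec y))"

definition clifford_star :: "'a::euclidean_space clifford \<Rightarrow> 'a clifford" where
  "clifford_star \<eta> = clifford_eps (clifford_transpose \<eta>)"

definition twisted_conj :: "'a::euclidean_space clifford \<Rightarrow> 'a \<Rightarrow> 'a clifford" where
  "twisted_conj \<eta> y =
     clifford_eps \<eta> \<otimes>\<^bsub>real_clifford\<^esub> clifford_vec y \<otimes>\<^bsub>real_clifford\<^esub> inv\<^bsub>real_clifford\<^esub> \<eta>"

definition Pin :: "'a::euclidean_space clifford set" where
  "Pin =
     {\<eta> \<in> Units real_clifford.
        (\<forall>y. twisted_conj \<eta> y \<in> range clifford_vec) \<and>
        (clifford_star \<eta> \<otimes>\<^bsub>real_clifford\<^esub> \<eta>) [^]\<^bsub>real_clifford\<^esub> (2::nat) = \<one>\<^bsub>real_clifford\<^esub>}"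

text \<open>The map \<open>p\<close> takes values in \<open>E\<close>, which is identified with its (isomorphic) image in the Clifford
  algebra.\<close>

definition pin_map :: "'a::euclidean_space clifford \<Rightarrow> 'a \<Rightarrow> 'a" where
  "pin_map \<eta> y = inv_into UNIV clifford_vec (twisted_conj \<eta> y)"

definition pin_cover :: "('a::euclidean_space \<Rightarrow> 'a) set \<Rightarrow> 'a clifford set" where
  "pin_cover W = {\<eta> \<in> Pin. pin_map \<eta> \<in> W}"


section \<open>The AMA-Dirac element\<close>

type_synonym 'a ama_clifford =
  "('a cherednik \<times> ('a clifford \<times> 'a clifford) \<Rightarrow>\<^sub>0 complex) set"

definition ama_clifford ::
  "('a::euclidean_space \<Rightarrow> 'a) set \<Rightarrow> 'a dual set \<Rightarrow> ('a dual \<Rightarrow> complex) \<Rightarrow>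
     (nat \<Rightarrow> 'a) \<Rightarrow> (complex, 'a ama_clifford) module" where
  "ama_clifford W Rp c y = tensor_product (angular_momentum_algebra W Rp c y) clifford"

definition ama_dirac ::
  "('a::euclidean_space \<Rightarrow> 'a) set \<Rightarrow> 'a dual set \<Rightarrow> ('a dual \<Rightarrow> complex) \<Rightarrow>
     (nat \<Rightarrow> 'a) \<Rightarrow> 'a ama_clifford" where
  "ama_dirac W Rp c y =
     finsum (ama_clifford W Rp c y)
       (\<lambda>(i, j).
          pure_tensor (angular_momentum_algebra W Rp c y) clifford
            (angular_momentum W Rp c y i j)
            (clifford_of_real (clifford_vec (y i)) \<otimes>\<^bsub>clifford\<^esub> clifford_of_real (clifford_vec (y j))))
       (index_pairs DIM('a))"

text \<open>The linear map \<open>\<rho>\<close> on the group algebra of the Pin cover of \<open>W\<close>, whose elements are the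
  finitely supported functions on the cover; \<^term>\<open>Poly_Mapping.single \<eta> 1\<close> is the group element \<open>\<eta>\<close>.\<close>

definition ama_rho ::
  "('a::euclidean_space \<Rightarrow> 'a) set \<Rightarrow> 'a dual set \<Rightarrow> ('a dual \<Rightarrow> complex) \<Rightarrow>
     (nat \<Rightarrow> 'a) \<Rightarrow> ('a clifford \<Rightarrow>\<^sub>0 complex) \<Rightarrow> 'a ama_clifford" where
  "ama_rho W Rp c y f =
     (\<Oplus>\<^bsub>ama_clifford W Rp c y\<^esub>\<eta>\<in>Poly_Mapping.keys f.
        Poly_Mapping.lookup f \<eta> \<odot>\<^bsub>ama_clifford W Rp c y\<^esub>
          pure_tensor (angular_momentum_algebra W Rp c y) clifford
            (cherednik_w W Rp c (pin_map \<eta>)) (clifford_of_real \<eta>))"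

end

theory Submission
  imports Defs
begin

text \<open>
  For \<open>u, v \<in> E\<close> put \<open>M(u, v) = x(u) y(v) - x(v) y(u)\<close>, where \<open>x(u) = B(u, -)\<close>. The element
  \<open>\<Phi>(u, v, u', v') = M(u, v) \<otimes> c(u') c(v')\<close> is quadrilinear, and by antisymmetry of both factors
  \<open>2 D = \<Sum>\<^sub>i\<^sub>,\<^sub>j \<Phi>(y\<^sub>i, y\<^sub>j, y\<^sub>i, y\<^sub>j)\<close>, a double trace, which does not depend on the orthonormal basis.
  For \<open>\<eta>\<close> in the Pin cover with image \<open>w\<close>, one has \<open>w M(u, v) = M(w u, w v) w\<close>. Moreover
  \<open>\<epsilon>(\<eta>) c(u) = c(w u) \<eta>\<close>, and applying the involution \<open>\<epsilon>\<close> gives \<open>\<eta> c(u) = c(w u) \<epsilon>(\<eta>)\<close>; hence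
  \<open>\<eta> c(u) c(v) = c(w u) c(w v) \<eta>\<close>, whatever the parity of \<open>\<eta>\<close>. So conjugation by \<open>\<rho>(\<eta>)\<close> turns \<open>D\<close>
  for the basis \<open>y\<close> into \<open>D\<close> for the orthonormal basis \<open>w y\<close>.
\<close>

section \<open>Associative algebras and their quotients\<close>

text \<open>For two bases the elements D lie a priori in different rings: the generators of
  \<open>angular_momentum_algebra\<close> depend on \<open>y\<close>, and a
  \<open>pure_tensor\<close> is a coset of an ideal that depends on both tensor factors. So the
  comparison rests on an equality of algebras: for every orthonormal basis the algebra is
  \<open>AMA\<close>, generated by W and the M(u, v) for all vectors, and all computations take
  place in the single ring \<open>P\<close>. Replacing the sum over i < j by the sum over all pairs
  is delicate: c(u) c(v) is antisymmetric only for orthogonal u and v, and the diagonal terms, where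
  c(u) c(u) is not 0, have to be killed by M(u, u) = 0. The resulting factor 2 is removed by the
  scalar 1/2. A second obstacle comes from the presentations. Maps between quotients are given as
  images of cosets, and such an image is an element of the quotient only when it is again a whole
  coset. An inverse that also preserves the relators guarantees this, both for the action of W on
  the tensor algebra and for \<epsilon> on the Clifford algebra.\<close>

lemma ring_update_more:
  assumes "ring R" "carrier R' = carrier R" "mult R' = mult R" "one R' = one R"
    "zero R' = zero R" "add R' = add R"
  shows "ring R'"
proof -
  interpret ring R by fact
  show ?thesis
    by (rule ringI; (rule abelian_groupI | rule monoidI)?)
      (auto simp: assms(2-) a_assoc m_assoc l_distr r_distr intro: a_comm
        intro!: bexI[where P = "\<lambda>y. y \<oplus>\<^bsub>R\<^esub> _ = \<zero>\<^bsub>R\<^esub>", OF l_neg])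
qed

text \<open>Without commutativity neither of the two laws relating scalars and products implies the
  other; together they make the elements z 1 central.\<close>

locale associative_algebra = ring A for A :: "('k::field, 'x) module" (structure) +
  assumes smult_closed [simp]: "a \<in> carrier A \<Longrightarrow> z \<odot> a \<in> carrier A"
    and smult_l_distr: "a \<in> carrier A \<Longrightarrow> (z + z') \<odot> a = z \<odot> a \<oplus> z' \<odot> a"
    and smult_r_distr: "a \<in> carrier A \<Longrightarrow> b \<in> carrier A \<Longrightarrow> z \<odot> (a \<oplus> b) = z \<odot> a \<oplus> z \<odot> b"
    and smult_assoc: "a \<in> carrier A \<Longrightarrow> (z * z') \<odot> a = z \<odot> (z' \<odot> a)"
    and smult_one [simp]: "a \<in> carrier A \<Longrightarrow> 1 \<odot> a = a"
    and smult_mult_left: "a \<in> carrier A \<Longrightarrow> b \<in> carrier A \<Longrightarrow> (z \<odot> a) \<otimes> b = z \<odot> (a \<otimes> b)"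
    and smult_mult_right: "a \<in> carrier A \<Longrightarrow> b \<in> carrier A \<Longrightarrow> a \<otimes> (z \<odot> b) = z \<odot> (a \<otimes> b)"
begin

lemma smult_zero_left [simp]:
  assumes "a \<in> carrier A"
  shows "0 \<odot> a = \<zero>"
  using smult_l_distr[OF assms, of 0 0] assms by (simp add: add.l_cancel_one')

lemma smult_zero_right [simp]: "z \<odot> \<zero> = \<zero>"
  using smult_r_distr[of \<zero> \<zero> z] by (simp add: add.l_cancel_one')

lemma smult_minus_right:
  assumes "a \<in> carrier A"
  shows "z \<odot> (\<ominus> a) = \<ominus> (z \<odot> a)"
  using smult_r_distr[of "\<ominus> a" a z] assms
  by (simp add: l_neg minus_equality)

lemma smult_minus_left:
  assumes "a \<in> carrier A"
  shows "(- z) \<odot> a = \<ominus> (z \<odot> a)"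
  using smult_l_distr[OF assms, of "- z" z] assms
  by (simp add: minus_equality)

lemma minus_eq_smult:
  assumes "a \<in> carrier A"
  shows "\<ominus> a = (- 1) \<odot> a"
  using smult_minus_left[OF assms, of 1] assms by simp

end

lemma algebra_homD:
  assumes "f \<in> algebra_hom A B"
  shows "f \<in> ring_hom A B"
    and "a \<in> carrier A \<Longrightarrow> f a \<in> carrier B"
    and "a \<in> carrier A \<Longrightarrow> b \<in> carrier A \<Longrightarrow> f (a \<oplus>\<^bsub>A\<^esub> b) = f a \<oplus>\<^bsub>B\<^esub> f b"
    and "a \<in> carrier A \<Longrightarrow> b \<in> carrier A \<Longrightarrow> f (a \<otimes>\<^bsub>A\<^esub> b) = f a \<otimes>\<^bsub>B\<^esub> f b"
    and "f \<one>\<^bsub>A\<^esub> = \<one>\<^bsub>B\<^esub>"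
    and "a \<in> carrier A \<Longrightarrow> f (z \<odot>\<^bsub>A\<^esub> a) = z \<odot>\<^bsub>B\<^esub> f a"
  using assms by (auto simp: algebra_hom_def ring_hom_def)

lemma algebra_hom_zero:
  assumes "associative_algebra A" "associative_algebra B" "f \<in> algebra_hom A B"
  shows "f \<zero>\<^bsub>A\<^esub> = \<zero>\<^bsub>B\<^esub>"
  using assms by (meson algebra_homD(1) associative_algebra_def ring_hom_zero)

lemma algebra_hom_minus:
  assumes "associative_algebra A" "associative_algebra B" "f \<in> algebra_hom A B" "a \<in> carrier A"
  shows "f (\<ominus>\<^bsub>A\<^esub> a) = \<ominus>\<^bsub>B\<^esub> f a"
  using assms associative_algebra.minus_eq_smult algebra_homD(2,6)
  by metis

lemma algebra_hom_diff:
  assumes "associative_algebra A" "associative_algebra B" "f \<in> algebra_hom A B"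
    "a \<in> carrier A" "b \<in> carrier A"
  shows "f (a \<ominus>\<^bsub>A\<^esub> b) = f a \<ominus>\<^bsub>B\<^esub> f b"
proof -
  interpret A: associative_algebra A by fact
  show ?thesis
    using assms by (simp add: a_minus_def algebra_homD(3)[OF assms(3)] algebra_hom_minus)
qed

lemma algebra_hom_comp:
  assumes "f \<in> algebra_hom A B" "g \<in> algebra_hom B C"
  shows "g \<circ> f \<in> algebra_hom A C"
  unfolding algebra_hom_def ring_hom_def
  using algebra_homD(2-)[OF assms(1)] algebra_homD(2-)[OF assms(2)] by auto

text \<open>The scalar laws are equations, so they pass to a surjective image by choosing preimages.
  The ring axioms of the image are a separate hypothesis because for quotients they come from the
  theory of ideals.\<close>

lemma associative_algebra_surj_image:
  fixes A :: "('k::field, 'x) module" and Q :: "('k, 'y) module"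
  assumes "associative_algebra A" "ring Q" "q \<in> algebra_hom A Q" "carrier Q = q ` carrier A"
  shows "associative_algebra Q"
proof -
  interpret A: associative_algebra A by fact
  interpret Q: ring Q by fact
  note q = algebra_homD[OF assms(3)]
  show ?thesis
  proof
    fix z z' :: 'k and a b assume "a \<in> carrier Q"
    then obtain a' where a': "a' \<in> carrier A" "a = q a'"
      using assms(4) by auto
    show "z \<odot>\<^bsub>Q\<^esub> a \<in> carrier Q"
      using a' q(2,6) A.smult_closed by metis
    show "(z + z') \<odot>\<^bsub>Q\<^esub> a = z \<odot>\<^bsub>Q\<^esub> a \<oplus>\<^bsub>Q\<^esub> z' \<odot>\<^bsub>Q\<^esub> a"
      using a' q(3,6) A.smult_closed A.smult_l_distr by metis
    show "(z * z') \<odot>\<^bsub>Q\<^esub> a = z \<odot>\<^bsub>Q\<^esub> (z' \<odot>\<^bsub>Q\<^esub> a)"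
      using a' q(3,6) A.smult_closed A.smult_assoc by metis
    show "1 \<odot>\<^bsub>Q\<^esub> a = a"
      using a' q(6) A.smult_one by metis
    assume "b \<in> carrier Q"
    then obtain b' where b': "b' \<in> carrier A" "b = q b'"
      using assms(4) by auto
    show "z \<odot>\<^bsub>Q\<^esub> (a \<oplus>\<^bsub>Q\<^esub> b) = z \<odot>\<^bsub>Q\<^esub> a \<oplus>\<^bsub>Q\<^esub> z \<odot>\<^bsub>Q\<^esub> b"
      using a' b' q(3,6) A.smult_closed A.a_closed A.smult_r_distr by metis
    show "(z \<odot>\<^bsub>Q\<^esub> a) \<otimes>\<^bsub>Q\<^esub> b = z \<odot>\<^bsub>Q\<^esub> (a \<otimes>\<^bsub>Q\<^esub> b)"
      using a' b' q(4,6) A.smult_closed A.m_closed A.smult_mult_left by metis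
    show "a \<otimes>\<^bsub>Q\<^esub> (z \<odot>\<^bsub>Q\<^esub> b) = z \<odot>\<^bsub>Q\<^esub> (a \<otimes>\<^bsub>Q\<^esub> b)"
      using a' b' q(4,6) A.smult_closed A.m_closed A.smult_mult_right by metis
  qed
qed

section \<open>Quotients of an algebra by the ideal generated by relators\<close>

context associative_algebra
begin

text \<open>Since z a = (z 1) a, absorption of ring elements already gives absorption of
  scalars.\<close>

lemma smult_ideal:
  assumes "ideal I A" "a \<in> I"
  shows "z \<odot> a \<in> I"
proof -
  interpret ideal I A by fact
  have "(z \<odot> \<one>) \<otimes> a \<in> I"
    using assms(2) I_l_closed by simp
  then show ?thesis
    using a_Hcarr[OF assms(2)] by (simp add: smult_mult_left)
qed

context
  fixes S
  assumes S: "S \<subseteq> carrier A"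
begin

interpretation I: ideal "Idl S" A
  by (rule genideal_ideal[OF S])

lemma quotient_class_eq_iff:
  assumes "a \<in> carrier A" "b \<in> carrier A"
  shows "quotient_class A S a = quotient_class A S b \<longleftrightarrow> a \<ominus> b \<in> Idl S"
  using quotient_eq_iff_same_a_r_cos[OF I.is_ideal assms] by (simp add: quotient_class_def)

text \<open>The form in which the defining relations of the tensor product, the tensor algebra and
  the Clifford algebra are extracted from their presentations.\<close>

lemma quotient_class_relator:
  assumes "a \<in> carrier A" "b \<in> carrier A" "a \<ominus> b \<in> S"
  shows "quotient_class A S a = quotient_class A S b"
  using assms genideal_self[OF S] by (auto simp: quotient_class_eq_iff)

lemma mem_quotient_class:
  assumes "a \<in> carrier A"
  shows "b \<in> quotient_class A S a \<longleftrightarrow> b \<in> carrier A \<and> quotient_class A S b = quotient_class A S a"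
proof
  assume "b \<in> quotient_class A S a"
  then obtain i where i: "i \<in> Idl S" "b = i \<oplus> a"
    by (auto simp: quotient_class_def a_r_coset_def')
  then have "b \<ominus> a = i"
    using I.Icarr assms by (simp add: a_minus_def a_assoc r_neg)
  then show "b \<in> carrier A \<and> quotient_class A S b = quotient_class A S a"
    using i I.Icarr assms by (simp add: quotient_class_eq_iff)
next
  assume "b \<in> carrier A \<and> quotient_class A S b = quotient_class A S a"
  then show "b \<in> quotient_class A S a"
    using I.a_rcos_self by (metis quotient_class_def)
qed

lemma quotient_algebra_carrier:
  "carrier (quotient_algebra A S) = quotient_class A S ` carrier A"
  by (auto simp: quotient_algebra_def ring.extend_def FactRing_simps quotient_class_def)

text \<open>The scalar multiple of a coset is defined as a union over its members. If b and a are
  members, z b - z a = z (b - a) stays in the ideal, so all sets in the union coincide.\<close>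

lemma quotient_class_smult:
  assumes "a \<in> carrier A"
  shows "quotient_class A S (z \<odot> a) = z \<odot>\<^bsub>quotient_algebra A S\<^esub> quotient_class A S a"
proof -
  have "quotient_class A S (z \<odot> b) = quotient_class A S (z \<odot> a)" if "b \<in> quotient_class A S a" for b
  proof -
    have b: "b \<in> carrier A" "b \<ominus> a \<in> Idl S"
      using that assms mem_quotient_class quotient_class_eq_iff by auto
    then have "z \<odot> (b \<ominus> a) \<in> Idl S"
      using smult_ideal I.is_ideal by blast
    also have "z \<odot> (b \<ominus> a) = z \<odot> b \<ominus> z \<odot> a"
      using b assms by (simp add: a_minus_def smult_r_distr smult_minus_right)
    finally show ?thesis
      using b assms by (simp add: quotient_class_eq_iff)
  qed
  \<comment> \<open>A union of equal sets is that set only over a nonempty index set.\<close>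
  moreover have "a \<in> quotient_class A S a"
    using assms mem_quotient_class by auto
  ultimately have "(\<Union>b\<in>quotient_class A S a. quotient_class A S (z \<odot> b)) = quotient_class A S (z \<odot> a)"
    by blast
  then show ?thesis
    by (simp add: quotient_algebra_def ring.extend_def module.fields_def)
qed

text \<open>\<open>ring.extend\<close> adds the scalars and leaves the ring operations of the
  \<open>Quot\<close> ring untouched, so its ring axioms carry over.\<close>

lemma quotient_algebra_ring: "ring (quotient_algebra A S)"
  by (rule ring_update_more[OF I.quotient_is_ring])
    (simp_all add: quotient_algebra_def ring.extend_def)

lemma quotient_class_hom: "quotient_class A S \<in> algebra_hom A (quotient_algebra A S)"
  using I.rcos_ring_hom
  by (auto simp: algebra_hom_def quotient_class_smult)
    (auto simp: quotient_algebra_def ring.extend_def quotient_class_def ring_hom_def)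

lemma associative_quotient_algebra: "associative_algebra (quotient_algebra A S)"
  by (rule associative_algebra_surj_image[OF associative_algebra_axioms quotient_algebra_ring
        quotient_class_hom quotient_algebra_carrier])

lemmas quotient_class_simps =
  algebra_homD(2-5)[OF quotient_class_hom]
  algebra_hom_zero[OF associative_algebra_axioms associative_quotient_algebra quotient_class_hom]
  algebra_hom_minus[OF associative_algebra_axioms associative_quotient_algebra quotient_class_hom]
  algebra_hom_diff[OF associative_algebra_axioms associative_quotient_algebra quotient_class_hom]
  quotient_class_smult

end

text \<open>The preimage of \<open>Idl S\<close> under h is an ideal containing S, and
  \<open>Idl S\<close> is the least such ideal.\<close>

lemma hom_Idl_subset:
  assumes S: "S \<subseteq> carrier A" and h: "h \<in> algebra_hom A A" and hS: "h ` S \<subseteq> S"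
  shows "h ` (Idl S) \<subseteq> Idl S"
proof -
  interpret I: ideal "Idl S" A
    by (rule genideal_ideal[OF S])
  note hD = algebra_homD[OF h]
  have "ideal {a \<in> carrier A. h a \<in> Idl S} A"
  proof (rule idealI)
    show "subgroup {a \<in> carrier A. h a \<in> Idl S} (add_monoid A)"
    proof (rule add.subgroupI)
      show "{a \<in> carrier A. h a \<in> Idl S} \<noteq> {}"
        using algebra_hom_zero[OF associative_algebra_axioms associative_algebra_axioms h]
        by (metis (mono_tags, lifting) I.zero_closed empty_iff mem_Collect_eq zero_closed)
    qed (auto simp: hD algebra_hom_minus[OF associative_algebra_axioms associative_algebra_axioms h]
          simp flip: a_inv_def)
  qed (auto simp: hD I.I_l_closed I.I_r_closed ring_axioms)
  moreover have "S \<subseteq> {a \<in> carrier A. h a \<in> Idl S}"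
    using S hS genideal_self[OF S] by auto
  ultimately show ?thesis
    using genideal_minimal by blast
qed

text \<open>A homomorphism that preserves the relators maps a coset into a coset, in general not
  onto it. The right inverse h', which preserves them too, yields h(\<open>Idl S\<close>) =
  \<open>Idl S\<close>, and then the image is a whole coset.\<close>

lemma hom_image_quotient_class:
  assumes S: "S \<subseteq> carrier A" and h: "h \<in> algebra_hom A A" "h ` S \<subseteq> S"
    and h': "h' \<in> algebra_hom A A" "h' ` S \<subseteq> S"
    and inv: "\<And>a. a \<in> carrier A \<Longrightarrow> h (h' a) = a" and a: "a \<in> carrier A"
  shows "h ` quotient_class A S a = quotient_class A S (h a)"
proof -
  interpret I: ideal "Idl S" A
    by (rule genideal_ideal[OF S])
  have "Idl S \<subseteq> h ` h' ` (Idl S)"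
    using inv[OF I.Icarr] by (force simp: image_image)
  also have "\<dots> \<subseteq> h ` (Idl S)"
    by (rule image_mono[OF hom_Idl_subset[OF S h']])
  finally have eq: "h ` (Idl S) = Idl S"
    using hom_Idl_subset[OF S h] by (rule subset_antisym[rotated])
  have "h ` (Idl S +> a) = (\<lambda>i. h (i \<oplus> a)) ` (Idl S)"
    by (auto simp: a_r_coset_def')
  also have "\<dots> = (\<lambda>i. h i \<oplus> h a) ` (Idl S)"
    using a I.Icarr algebra_homD(3)[OF h(1)] by (intro image_cong) auto
  also have "\<dots> = (\<lambda>i. i \<oplus> h a) ` h ` (Idl S)"
    by (auto simp: image_image)
  also have "\<dots> = Idl S +> h a"
    unfolding eq by (auto simp: a_r_coset_def')
  finally show ?thesis
    by (simp add: quotient_class_def)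
qed

text \<open>The induced map on the quotient is literally the image map on sets, the form in which
  \<open>tensor_map\<close> is given. It serves twice: for linear automorphisms acting on the tensor
  algebra and for the sign involution of the Clifford algebra.\<close>

lemma induced_hom_quotient:
  assumes S: "S \<subseteq> carrier A" and h: "h \<in> algebra_hom A A" "h ` S \<subseteq> S"
    and h': "h' \<in> algebra_hom A A" "h' ` S \<subseteq> S"
    and inv: "\<And>a. a \<in> carrier A \<Longrightarrow> h (h' a) = a"
  shows "(`) h \<in> algebra_hom (quotient_algebra A S) (quotient_algebra A S)"
proof -
  note img = hom_image_quotient_class[OF assms]
  note hD = algebra_homD[OF h(1)] and q = quotient_class_simps(2-)[OF S, symmetric]
    and c = quotient_algebra_carrier[OF S]
  show ?thesis
    unfolding algebra_hom_def
  proof (intro CollectI conjI ring_hom_memI allI ballI)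
    fix K assume "K \<in> carrier (quotient_algebra A S)"
    then obtain a where a: "a \<in> carrier A" "K = quotient_class A S a"
      by (auto simp: c)
    then show "h ` K \<in> carrier (quotient_algebra A S)"
      by (simp add: img c hD)
    fix L assume "L \<in> carrier (quotient_algebra A S)"
    then obtain b where b: "b \<in> carrier A" "L = quotient_class A S b"
      by (auto simp: c)
    show "h ` (K \<otimes>\<^bsub>quotient_algebra A S\<^esub> L) = h ` K \<otimes>\<^bsub>quotient_algebra A S\<^esub> h ` L"
      using a b by (simp add: img q(2) hD)
    show "h ` (K \<oplus>\<^bsub>quotient_algebra A S\<^esub> L) = h ` K \<oplus>\<^bsub>quotient_algebra A S\<^esub> h ` L"
      using a b by (simp add: img q(1) hD)
  next
    show "h ` \<one>\<^bsub>quotient_algebra A S\<^esub> = \<one>\<^bsub>quotient_algebra A S\<^esub>"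
      by (simp add: img q(3) hD)
  next
    fix z K assume "K \<in> carrier (quotient_algebra A S)"
    then obtain a where a: "a \<in> carrier A" "K = quotient_class A S a"
      by (auto simp: c)
    show "h ` (z \<odot>\<^bsub>quotient_algebra A S\<^esub> K) = z \<odot>\<^bsub>quotient_algebra A S\<^esub> h ` K"
      using a by (simp add: img q(7) hD)
  qed
qed

section \<open>Subalgebras generated by a set\<close>

lemma carrier_generated_subalgebra:
  "carrier (generated_subalgebra A S) =
    \<Inter>{T. subring T A \<and> (\<forall>z. \<forall>a\<in>T. z \<odot> a \<in> T) \<and> S \<subseteq> T}"
  by (simp add: generated_subalgebra_def)

lemma generated_subalgebra_simps [simp]:
  "mult (generated_subalgebra A S) = mult A" "one (generated_subalgebra A S) = one A"
  "add (generated_subalgebra A S) = add A" "zero (generated_subalgebra A S) = zero A"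
  "smult (generated_subalgebra A S) = smult A"
  by (simp_all add: generated_subalgebra_def)

lemma generated_subalgebra_self: "S \<subseteq> carrier (generated_subalgebra A S)"
  by (auto simp: carrier_generated_subalgebra)

lemma generated_subalgebra_subset:
  "S \<subseteq> carrier A \<Longrightarrow> carrier (generated_subalgebra A S) \<subseteq> carrier A"
  using carrier_is_subring by (auto simp: carrier_generated_subalgebra)

lemma generated_subalgebra_subring:
  assumes "S \<subseteq> carrier A"
  shows "subring (carrier (generated_subalgebra A S)) A"
  unfolding carrier_generated_subalgebra
  using assms carrier_is_subring by (intro subring_Inter) auto

lemma associative_generated_subalgebra:
  assumes "S \<subseteq> carrier A"
  shows "associative_algebra (generated_subalgebra A S)"
proof -
  have "ring (generated_subalgebra A S)"
    using subring_is_ring[OF generated_subalgebra_subring[OF assms]]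
    by (simp add: generated_subalgebra_def)
  moreover have "a \<in> carrier A" if "a \<in> carrier (generated_subalgebra A S)" for a
    using that generated_subalgebra_subset[OF assms] by auto
  moreover have "z \<odot> a \<in> carrier (generated_subalgebra A S)"
    if "a \<in> carrier (generated_subalgebra A S)" for z a
    using that by (simp add: carrier_generated_subalgebra)
  ultimately show ?thesis
    by (intro associative_algebra.intro associative_algebra_axioms.intro)
      (simp_all add: smult_l_distr smult_r_distr smult_assoc smult_mult_left smult_mult_right)
qed

end

section \<open>Monoid algebras and tensor products\<close>

lemma poly_mapping_sum_single: "(\<Sum>a\<in>Poly_Mapping.keys f. Poly_Mapping.single a (Poly_Mapping.lookup f a)) = f"
  by (rule poly_mapping_eqI) (simp add: lookup_sum lookup_single when_def in_keys_iff)

lemma lookup_map_times [simp]: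
  fixes z :: "'k::field"
  shows "Poly_Mapping.lookup (Poly_Mapping.map ((*) z) f) a = z * Poly_Mapping.lookup f a"
  by (simp add: Poly_Mapping.map.rep_eq when_def)

lemma map_times_single [simp]:
  "Poly_Mapping.map ((*) z) (Poly_Mapping.single a x) = Poly_Mapping.single a (z * x :: 'k::field)"
  by (rule poly_mapping_eqI) (simp add: lookup_single when_def)

lemma monoid_algebra_simps [simp]:
  "carrier (monoid_algebra G) = {f. Poly_Mapping.keys f \<subseteq> carrier G}"
  "one (monoid_algebra G) = Poly_Mapping.single \<one>\<^bsub>G\<^esub> 1"
  "zero (monoid_algebra G) = 0"
  "add (monoid_algebra G) = (+)"
  "smult (monoid_algebra G) = (\<lambda>z. Poly_Mapping.map ((*) z))"
  by (simp_all add: monoid_algebra_def)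

text \<open>Cancellation may shrink the support of a sum. Enlarging the index sets adds only zero
  terms, so distributivity can be checked over one common index set.\<close>

lemma monoid_algebra_mult_superset:
  assumes "finite A" "Poly_Mapping.keys f \<subseteq> A" "finite B" "Poly_Mapping.keys g \<subseteq> B"
  shows "f \<otimes>\<^bsub>monoid_algebra G\<^esub> g =
    (\<Sum>a\<in>A. \<Sum>b\<in>B. Poly_Mapping.single (a \<otimes>\<^bsub>G\<^esub> b) (Poly_Mapping.lookup f a * Poly_Mapping.lookup g b))"
proof -
  have "f \<otimes>\<^bsub>monoid_algebra G\<^esub> g =
    (\<Sum>a\<in>Poly_Mapping.keys f. \<Sum>b\<in>B.
       Poly_Mapping.single (a \<otimes>\<^bsub>G\<^esub> b) (Poly_Mapping.lookup f a * Poly_Mapping.lookup g b))"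
    unfolding monoid_algebra_def monoid.simps
    using assms(3,4) by (intro sum.cong refl sum.mono_neutral_left) (auto simp: in_keys_iff)
  also have "\<dots> = (\<Sum>a\<in>A. \<Sum>b\<in>B.
       Poly_Mapping.single (a \<otimes>\<^bsub>G\<^esub> b) (Poly_Mapping.lookup f a * Poly_Mapping.lookup g b))"
    using assms(1,2)
    by (auto simp: in_keys_iff intro!: sum.mono_neutral_left)
  finally show ?thesis .
qed

lemma monoid_algebra_mult_add_left:
  "(f + f') \<otimes>\<^bsub>monoid_algebra G\<^esub> g = f \<otimes>\<^bsub>monoid_algebra G\<^esub> g + f' \<otimes>\<^bsub>monoid_algebra G\<^esub> g"
proof -
  let ?A = "Poly_Mapping.keys f \<union> Poly_Mapping.keys f'" and ?B = "Poly_Mapping.keys g"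
  note * = monoid_algebra_mult_superset[where A = ?A and B = ?B]
  show ?thesis
    using Poly_Mapping.keys_add[of f f']
    by (simp add: * lookup_add distrib_right single_add sum.distrib)
qed

lemma monoid_algebra_mult_add_right:
  "f \<otimes>\<^bsub>monoid_algebra G\<^esub> (g + g') = f \<otimes>\<^bsub>monoid_algebra G\<^esub> g + f \<otimes>\<^bsub>monoid_algebra G\<^esub> g'"
proof -
  let ?B = "Poly_Mapping.keys g \<union> Poly_Mapping.keys g'" and ?A = "Poly_Mapping.keys f"
  note * = monoid_algebra_mult_superset[where A = ?A and B = ?B]
  show ?thesis
    using Poly_Mapping.keys_add[of g g']
    by (simp add: * lookup_add distrib_left single_add sum.distrib)
qed

lemma monoid_algebra_mult_zero [simp]:
  "0 \<otimes>\<^bsub>monoid_algebra G\<^esub> g = 0" "f \<otimes>\<^bsub>monoid_algebra G\<^esub> 0 = 0"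
  by (simp_all add: monoid_algebra_def)

lemma monoid_algebra_mult_single [simp]:
  "Poly_Mapping.single a x \<otimes>\<^bsub>monoid_algebra G\<^esub> Poly_Mapping.single b y =
    Poly_Mapping.single (a \<otimes>\<^bsub>G\<^esub> b) (x * y)"
  by (subst monoid_algebra_mult_superset[where A = "{a}" and B = "{b}"]) auto

lemma keys_add_subset:
  "Poly_Mapping.keys f \<subseteq> X \<Longrightarrow> Poly_Mapping.keys g \<subseteq> X \<Longrightarrow> Poly_Mapping.keys (f + g) \<subseteq> X"
  using Poly_Mapping.keys_add[of f g] by (meson Un_least order_trans)

text \<open>Reduces additive statements to single terms. The supports remain inside X throughout, so
  membership in a carrier stays available in every case.\<close>

lemma poly_mapping_additive_induct [consumes 1, case_names zero add single]:
  fixes f :: "'g \<Rightarrow>\<^sub>0 'k::comm_monoid_add"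
  assumes "Poly_Mapping.keys f \<subseteq> X"
    and "P 0"
    and add: "\<And>f g. Poly_Mapping.keys f \<subseteq> X \<Longrightarrow> Poly_Mapping.keys g \<subseteq> X \<Longrightarrow> P f \<Longrightarrow> P g \<Longrightarrow> P (f + g)"
    and single: "\<And>a z. a \<in> X \<Longrightarrow> P (Poly_Mapping.single a z)"
  shows "P f"
proof -
  have "Poly_Mapping.keys (\<Sum>a\<in>A. Poly_Mapping.single a (Poly_Mapping.lookup f a)) \<subseteq> X \<and>
      P (\<Sum>a\<in>A. Poly_Mapping.single a (Poly_Mapping.lookup f a))"
    if "finite A" "A \<subseteq> X" for A
    using that
  proof (induction rule: finite_induct)
    case empty
    then show ?case using assms(2) by simp
  next
    case (insert a A)
    let ?s = "Poly_Mapping.single a (Poly_Mapping.lookup f a)"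
    have s: "Poly_Mapping.keys ?s \<subseteq> X"
      using insert.prems by (auto split: if_splits)
    then show ?case
      using insert keys_add_subset[OF s, of "\<Sum>a\<in>A. Poly_Mapping.single a (Poly_Mapping.lookup f a)"]
      by (auto intro!: add single)
  qed
  then show ?thesis
    using assms(1) poly_mapping_sum_single[of f] by (metis finite_keys)
qed

lemma monoid_algebra_smult_add:
  fixes f g :: "'g \<Rightarrow>\<^sub>0 'k::field"
  shows "Poly_Mapping.map ((*) z) (f + g) = Poly_Mapping.map ((*) z) f + Poly_Mapping.map ((*) z) g"
  by (rule poly_mapping_eqI) (simp add: lookup_add distrib_left)

lemma map_times_zero [simp]:
  "Poly_Mapping.map ((*) z) 0 = (0 :: 'g \<Rightarrow>\<^sub>0 'k::field)"
  by (rule poly_mapping_eqI) simp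

lemma keys_map_times_subset:
  fixes f :: "'g \<Rightarrow>\<^sub>0 'k::field"
  shows "Poly_Mapping.keys (Poly_Mapping.map ((*) z) f) \<subseteq> Poly_Mapping.keys f"
  by (auto simp: in_keys_iff)

lemma associative_monoid_algebra:
  assumes "Group.monoid G"
  shows "associative_algebra (monoid_algebra G :: ('k::field, 'g \<Rightarrow>\<^sub>0 'k) module)"
proof -
  interpret Group.monoid G by fact
  let ?M = "monoid_algebra G :: ('k, 'g \<Rightarrow>\<^sub>0 'k) module"
  have closed: "f \<otimes>\<^bsub>?M\<^esub> g \<in> carrier ?M" if "f \<in> carrier ?M" "g \<in> carrier ?M" for f g
  proof -
    have "Poly_Mapping.keys f \<subseteq> carrier G" "Poly_Mapping.keys g \<subseteq> carrier G"
      using that by auto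
    then show ?thesis
    proof (induction f rule: poly_mapping_additive_induct)
      case (add f f')
      then show ?case
        by (simp add: monoid_algebra_mult_add_left keys_add_subset)
    next
      case (single a z)
      from single(2,1) show ?case
      proof (induction g rule: poly_mapping_additive_induct)
        case (add f f')
        then show ?case
          by (simp add: monoid_algebra_mult_add_right keys_add_subset)
      qed auto
    qed simp
  qed
  have assoc: "f \<otimes>\<^bsub>?M\<^esub> g \<otimes>\<^bsub>?M\<^esub> h = f \<otimes>\<^bsub>?M\<^esub> (g \<otimes>\<^bsub>?M\<^esub> h)"
    if "f \<in> carrier ?M" "g \<in> carrier ?M" "h \<in> carrier ?M" for f g h
  proof -
    have "Poly_Mapping.keys f \<subseteq> carrier G" "Poly_Mapping.keys g \<subseteq> carrier G"
      "Poly_Mapping.keys h \<subseteq> carrier G"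
      using that by auto
    then show ?thesis
    proof (induction f rule: poly_mapping_additive_induct)
      case (single a x)
      from single(2,1,3) show ?case
      proof (induction g rule: poly_mapping_additive_induct)
        case (single b y)
        from single(3,1,2) show ?case
          by (induction h rule: poly_mapping_additive_induct)
            (simp_all add: monoid_algebra_mult_add_right m_assoc mult.assoc)
      qed (simp_all add: monoid_algebra_mult_add_right monoid_algebra_mult_add_left)
    qed (simp_all add: monoid_algebra_mult_add_left)
  qed
  have one: "\<one>\<^bsub>?M\<^esub> \<otimes>\<^bsub>?M\<^esub> f = f \<and> f \<otimes>\<^bsub>?M\<^esub> \<one>\<^bsub>?M\<^esub> = f" if "f \<in> carrier ?M" for f
  proof -
    have "Poly_Mapping.keys f \<subseteq> carrier G"
      using that by auto
    then show ?thesis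
      by (induction f rule: poly_mapping_additive_induct)
        (simp_all add: monoid_algebra_mult_add_left monoid_algebra_mult_add_right)
  qed
  have smult: "Poly_Mapping.map ((*) z) f \<otimes>\<^bsub>?M\<^esub> g = Poly_Mapping.map ((*) z) (f \<otimes>\<^bsub>?M\<^esub> g) \<and>
      f \<otimes>\<^bsub>?M\<^esub> Poly_Mapping.map ((*) z) g = Poly_Mapping.map ((*) z) (f \<otimes>\<^bsub>?M\<^esub> g)"
    if "f \<in> carrier ?M" "g \<in> carrier ?M" for z f g
  proof -
    have "Poly_Mapping.keys f \<subseteq> carrier G" "Poly_Mapping.keys g \<subseteq> carrier G"
      using that by auto
    then show ?thesis
    proof (induction f rule: poly_mapping_additive_induct)
      case (single a x)
      from single(2,1) show ?case
        by (induction g rule: poly_mapping_additive_induct)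
          (simp_all add: monoid_algebra_mult_add_right monoid_algebra_smult_add mult.left_commute
            mult.assoc)
    qed (simp_all add: monoid_algebra_mult_add_left monoid_algebra_smult_add)
  qed
  have neg: "\<exists>g\<in>carrier ?M. g \<oplus>\<^bsub>?M\<^esub> f = \<zero>\<^bsub>?M\<^esub>" if "f \<in> carrier ?M" for f
    using that by (intro bexI[of _ "- f"]) (auto simp: in_keys_iff)
  have add: "f \<oplus>\<^bsub>?M\<^esub> g \<in> carrier ?M" if "f \<in> carrier ?M" "g \<in> carrier ?M" for f g
    using that by (simp add: keys_add_subset)
  have "ring ?M"
  proof (rule ringI)
    show "abelian_group ?M"
      by (rule abelian_groupI; (rule add neg)?) (auto simp: add.assoc add.commute)
    show "Group.monoid ?M"
      using closed assoc one by (auto intro!: monoidI simp del: monoid_algebra_simps(1))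
        (auto split: if_splits)
  qed (simp_all only: monoid_algebra_simps(4) monoid_algebra_mult_add_left
      monoid_algebra_mult_add_right)
  then show ?thesis
  proof (intro associative_algebra.intro associative_algebra_axioms.intro)
    show "z \<odot>\<^bsub>?M\<^esub> f \<in> carrier ?M" if "f \<in> carrier ?M" for z f
      using that keys_map_times_subset[of z f] by auto
  qed (use smult in \<open>auto intro!: poly_mapping_eqI simp: lookup_add algebra_simps\<close>)
qed

text \<open>Relators are written with the subtraction of the type, ideals with that of the ring
  record; on the carrier the two agree.\<close>

lemma monoid_algebra_diff:
  assumes "Group.monoid G" "f \<in> carrier (monoid_algebra G)" "g \<in> carrier (monoid_algebra G)"
  shows "f \<ominus>\<^bsub>monoid_algebra G\<^esub> g = f - g"
proof -
  interpret associative_algebra "monoid_algebra G"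
    by (rule associative_monoid_algebra) fact
  have "- g \<in> carrier (monoid_algebra G)"
    using assms(3) by (auto simp: in_keys_iff)
  then have "\<ominus>\<^bsub>monoid_algebra G\<^esub> g = - g"
    using assms(3) by (intro minus_equality) auto
  then show ?thesis
    by (simp add: a_minus_def)
qed

section \<open>Tensor products of algebras\<close>

lemma bilinear_relators_carrier:
  assumes "associative_algebra A" "associative_algebra B"
  shows "bilinear_relators A B \<subseteq> carrier (monoid_algebra (A \<times>\<times> B))"
proof -
  interpret A: associative_algebra A by fact
  interpret B: associative_algebra B by fact
  interpret M: associative_algebra "monoid_algebra (A \<times>\<times> B)"
    by (intro associative_monoid_algebra DirProd_monoid A.monoid_axioms B.monoid_axioms)
  let ?M = "monoid_algebra (A \<times>\<times> B)"
  have diff: "f - g \<in> carrier ?M" if "f \<in> carrier ?M" "g \<in> carrier ?M" for f g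
    using that M.minus_closed[OF that]
    by (simp only: monoid_algebra_diff[OF DirProd_monoid[OF A.monoid_axioms B.monoid_axioms] that])
  have single: "Poly_Mapping.single (a, b) z \<in> carrier ?M" if "a \<in> carrier A" "b \<in> carrier B" for a b z
    using that by (auto split: if_splits)
  show ?thesis
    unfolding bilinear_relators_def Let_def
    by (intro Un_least subsetI; elim CollectE exE conjE; hypsubst)
      (simp only: diff single A.a_closed B.a_closed A.smult_closed B.smult_closed map_times_single)+
qed

context
  fixes A :: "('k::field, 'x) module" and B :: "('k, 'y) module"
  assumes A: "associative_algebra A" and B: "associative_algebra B"
begin

interpretation A: associative_algebra A by (rule A)
interpretation B: associative_algebra B by (rule B)

lemma monoid_DirProd_algebra: "Group.monoid (A \<times>\<times> B)"
  by (intro DirProd_monoid A.monoid_axioms B.monoid_axioms)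

interpretation M: associative_algebra "monoid_algebra (A \<times>\<times> B)"
  by (rule associative_monoid_algebra[OF monoid_DirProd_algebra])

lemma associative_tensor_product: "associative_algebra (tensor_product A B)"
  unfolding tensor_product_def
  by (rule M.associative_quotient_algebra[OF bilinear_relators_carrier[OF A B]])

lemma single_tensor_carrier:
  assumes "a \<in> carrier A" "b \<in> carrier B"
  shows "Poly_Mapping.single (a, b) z \<in> carrier (monoid_algebra (A \<times>\<times> B))"
  using assms by (auto split: if_splits)

lemmas tensor_hom =
  M.quotient_class_simps[OF bilinear_relators_carrier[OF A B],
    folded tensor_product_def]

lemma pure_tensor_closed [simp]:
  assumes "a \<in> carrier A" "b \<in> carrier B"
  shows "pure_tensor A B a b \<in> carrier (tensor_product A B)"
  unfolding pure_tensor_def by (rule tensor_hom(1)[OF single_tensor_carrier[OF assms]])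

text \<open>The bilinearity laws below are all obtained in this way: before passing to cosets, the
  difference of the two sides is literally a relator.\<close>

lemma quotient_class_tensor_eqI:
  assumes "f \<in> carrier (monoid_algebra (A \<times>\<times> B))" "g \<in> carrier (monoid_algebra (A \<times>\<times> B))"
    and "f - g \<in> bilinear_relators A B"
  shows "quotient_class (monoid_algebra (A \<times>\<times> B)) (bilinear_relators A B) f =
    quotient_class (monoid_algebra (A \<times>\<times> B)) (bilinear_relators A B) g"
  using assms
  by (intro M.quotient_class_relator[OF bilinear_relators_carrier[OF A B]])
    (simp_all only: monoid_algebra_diff[OF monoid_DirProd_algebra])

lemma pure_tensor_add_left:
  assumes "a \<in> carrier A" "a' \<in> carrier A" "b \<in> carrier B"
  shows "pure_tensor A B (a \<oplus>\<^bsub>A\<^esub> a') b =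
    pure_tensor A B a b \<oplus>\<^bsub>tensor_product A B\<^esub> pure_tensor A B a' b"
  unfolding pure_tensor_def
  by (subst tensor_hom(2)[symmetric];
      (intro quotient_class_tensor_eqI M.a_closed single_tensor_carrier A.a_closed assms)?)
    (use assms in \<open>auto simp: bilinear_relators_def diff_diff_add[symmetric]\<close>)

lemma pure_tensor_add_right:
  assumes "a \<in> carrier A" "b \<in> carrier B" "b' \<in> carrier B"
  shows "pure_tensor A B a (b \<oplus>\<^bsub>B\<^esub> b') =
    pure_tensor A B a b \<oplus>\<^bsub>tensor_product A B\<^esub> pure_tensor A B a b'"
  unfolding pure_tensor_def
  by (subst tensor_hom(2)[symmetric];
      (intro quotient_class_tensor_eqI M.a_closed single_tensor_carrier B.a_closed assms)?)
    (use assms in \<open>auto simp: bilinear_relators_def diff_diff_add[symmetric]\<close>)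

lemma pure_tensor_smult_left:
  assumes "a \<in> carrier A" "b \<in> carrier B"
  shows "pure_tensor A B (z \<odot>\<^bsub>A\<^esub> a) b = z \<odot>\<^bsub>tensor_product A B\<^esub> pure_tensor A B a b"
  unfolding pure_tensor_def
  by (subst tensor_hom(8)[symmetric];
      (intro quotient_class_tensor_eqI M.smult_closed single_tensor_carrier A.smult_closed assms)?)
    (use assms in \<open>unfold bilinear_relators_def Let_def monoid_algebra_simps, blast\<close>)

lemma pure_tensor_smult_right:
  assumes "a \<in> carrier A" "b \<in> carrier B"
  shows "pure_tensor A B a (z \<odot>\<^bsub>B\<^esub> b) = z \<odot>\<^bsub>tensor_product A B\<^esub> pure_tensor A B a b"
  unfolding pure_tensor_def
  by (subst tensor_hom(8)[symmetric];
      (intro quotient_class_tensor_eqI M.smult_closed single_tensor_carrier B.smult_closed assms)?)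
    (use assms in \<open>unfold bilinear_relators_def Let_def monoid_algebra_simps, blast\<close>)

lemma pure_tensor_mult:
  assumes "a \<in> carrier A" "b \<in> carrier B" "a' \<in> carrier A" "b' \<in> carrier B"
  shows "pure_tensor A B a b \<otimes>\<^bsub>tensor_product A B\<^esub> pure_tensor A B a' b' =
    pure_tensor A B (a \<otimes>\<^bsub>A\<^esub> a') (b \<otimes>\<^bsub>B\<^esub> b')"
  unfolding pure_tensor_def
  by (subst tensor_hom(3)[symmetric]) (use assms in \<open>auto split: if_splits\<close>)

lemma pure_tensor_one: "pure_tensor A B \<one>\<^bsub>A\<^esub> \<one>\<^bsub>B\<^esub> = \<one>\<^bsub>tensor_product A B\<^esub>"
  using tensor_hom(4) by (simp add: pure_tensor_def)

end

section \<open>Complexifications and smash products\<close>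

lemma (in abelian_monoid) finsum_swap:
  assumes "finite X" "finite Y" "\<And>a b. a \<in> X \<Longrightarrow> b \<in> Y \<Longrightarrow> f a b \<in> carrier G"
  shows "(\<Oplus>a\<in>X. \<Oplus>b\<in>Y. f a b) = (\<Oplus>b\<in>Y. \<Oplus>a\<in>X. f a b)"
  using assms(1,3)
proof (induction X rule: finite_induct)
  case (insert x X)
  have closed: "(\<Oplus>a\<in>X. f a b) \<in> carrier G" if "b \<in> Y" for b
    using insert that by (intro finsum_closed) auto
  have "(\<Oplus>b\<in>Y. \<Oplus>a\<in>insert x X. f a b) = (\<Oplus>b\<in>Y. f x b \<oplus> (\<Oplus>a\<in>X. f a b))"
    using insert closed by (intro finsum_cong') auto
  also have "\<dots> = (\<Oplus>b\<in>Y. f x b) \<oplus> (\<Oplus>b\<in>Y. \<Oplus>a\<in>X. f a b)"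
    using insert closed by (intro finsum_addf) auto
  also have "\<dots> = (\<Oplus>a\<in>insert x X. \<Oplus>b\<in>Y. f a b)"
    using insert by (subst finsum_insert) (auto intro: finsum_closed)
  finally show ?case ..
qed simp

lemma associative_complexified_algebra:
  assumes "associative_algebra A"
  shows "associative_algebra (complexified_algebra A)"
proof -
  interpret A: associative_algebra A by fact
  let ?C = "complexified_algebra A"
  note simps = complexified_algebra_def a_minus_def A.l_distr A.r_distr A.l_minus A.r_minus
    A.minus_add A.m_assoc A.a_ac
  have "ring ?C"
  proof (rule ringI)
    show "abelian_group ?C"
    proof (rule abelian_groupI)
      show "\<exists>y\<in>carrier ?C. y \<oplus>\<^bsub>?C\<^esub> x = \<zero>\<^bsub>?C\<^esub>" if "x \<in> carrier ?C" for x
        using that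
        by (intro bexI[of _ "(\<ominus>\<^bsub>A\<^esub> fst x, \<ominus>\<^bsub>A\<^esub> snd x)"]) (auto simp: complexified_algebra_def A.l_neg)
    qed (auto simp: complexified_algebra_def A.a_ac)
    show "Group.monoid ?C"
      by (rule monoidI) (auto simp: simps)
  qed (auto simp: simps)
  then show ?thesis
    by (intro associative_algebra.intro associative_algebra_axioms.intro)
      (auto simp: simps A.smult_l_distr A.smult_r_distr A.smult_minus_right A.smult_minus_left
        A.smult_mult_left A.smult_mult_right A.smult_assoc diff_conv_add_uminus
        simp del: add_uminus_conv_diff simp flip: A.smult_assoc)
qed

section \<open>Smash products with a finite group\<close>

locale smash_product_algebra = A: associative_algebra A + G: group G
  for A :: "('k::field, 'x) module" and G :: "('g, 'm) monoid_scheme" +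
  fixes act :: "'g \<Rightarrow> 'x \<Rightarrow> 'x"
  assumes fin [simp]: "finite (carrier G)"
    and act_hom: "u \<in> carrier G \<Longrightarrow> act u \<in> algebra_hom A A"
    and act_one [simp]: "a \<in> carrier A \<Longrightarrow> act \<one>\<^bsub>G\<^esub> a = a"
    and act_mult: "u \<in> carrier G \<Longrightarrow> v \<in> carrier G \<Longrightarrow> a \<in> carrier A \<Longrightarrow>
      act (u \<otimes>\<^bsub>G\<^esub> v) a = act u (act v a)"
begin

abbreviation smash :: "('k, 'g \<Rightarrow> 'x) module" where
  "smash \<equiv> smash_product A G act"

lemma act_simps [simp]:
  assumes "u \<in> carrier G"
  shows "a \<in> carrier A \<Longrightarrow> act u a \<in> carrier A"
    and "a \<in> carrier A \<Longrightarrow> b \<in> carrier A \<Longrightarrow> act u (a \<oplus>\<^bsub>A\<^esub> b) = act u a \<oplus>\<^bsub>A\<^esub> act u b"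
    and "a \<in> carrier A \<Longrightarrow> b \<in> carrier A \<Longrightarrow> act u (a \<otimes>\<^bsub>A\<^esub> b) = act u a \<otimes>\<^bsub>A\<^esub> act u b"
    and "act u \<one>\<^bsub>A\<^esub> = \<one>\<^bsub>A\<^esub>"
    and "act u \<zero>\<^bsub>A\<^esub> = \<zero>\<^bsub>A\<^esub>"
    and "a \<in> carrier A \<Longrightarrow> act u (z \<odot>\<^bsub>A\<^esub> a) = z \<odot>\<^bsub>A\<^esub> act u a"
  using algebra_homD(2-)[OF act_hom[OF assms]]
    algebra_hom_zero[OF A.associative_algebra_axioms A.associative_algebra_axioms act_hom[OF assms]]
  by auto

lemma act_finsum:
  assumes "u \<in> carrier G" "f \<in> X \<rightarrow> carrier A"
  shows "act u (finsum A f X) = (\<Oplus>\<^bsub>A\<^esub>x\<in>X. act u (f x))"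
proof -
  interpret ring_hom_ring A A "act u"
    using algebra_homD(1)[OF act_hom[OF assms(1)]] by (rule ring_hom_ringI2[OF A.ring_axioms A.ring_axioms])
  show ?thesis
    using hom_finsum[OF assms(2)] by (simp add: comp_def)
qed

lemma smash_simps:
  "carrier smash = carrier G \<rightarrow>\<^sub>E carrier A"
  "\<one>\<^bsub>smash\<^esub> = (\<lambda>w\<in>carrier G. if w = \<one>\<^bsub>G\<^esub> then \<one>\<^bsub>A\<^esub> else \<zero>\<^bsub>A\<^esub>)"
  "\<zero>\<^bsub>smash\<^esub> = (\<lambda>w\<in>carrier G. \<zero>\<^bsub>A\<^esub>)"
  "f \<oplus>\<^bsub>smash\<^esub> g = (\<lambda>w\<in>carrier G. f w \<oplus>\<^bsub>A\<^esub> g w)"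
  "z \<odot>\<^bsub>smash\<^esub> f = (\<lambda>w\<in>carrier G. z \<odot>\<^bsub>A\<^esub> f w)"
  "f \<otimes>\<^bsub>smash\<^esub> g = (\<lambda>w\<in>carrier G. \<Oplus>\<^bsub>A\<^esub>u\<in>carrier G. f u \<otimes>\<^bsub>A\<^esub> act u (g (inv\<^bsub>G\<^esub> u \<otimes>\<^bsub>G\<^esub> w)))"
  by (simp_all add: smash_product_def)

lemma smash_apply [simp]:
  "f \<in> carrier smash \<Longrightarrow> w \<in> carrier G \<Longrightarrow> f w \<in> carrier A"
  by (auto simp: smash_simps)

lemma smash_eqI:
  assumes "f \<in> carrier smash" "g \<in> carrier smash" "\<And>w. w \<in> carrier G \<Longrightarrow> f w = g w"
  shows "f = g"
  using assms by (auto simp: smash_simps intro: PiE_ext)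

lemma smash_mult_closed [simp]:
  assumes "f \<in> carrier smash" "g \<in> carrier smash"
  shows "f \<otimes>\<^bsub>smash\<^esub> g \<in> carrier smash"
proof -
  have "(\<Oplus>\<^bsub>A\<^esub>u\<in>carrier G. f u \<otimes>\<^bsub>A\<^esub> act u (g (inv\<^bsub>G\<^esub> u \<otimes>\<^bsub>G\<^esub> w))) \<in> carrier A"
    if "w \<in> carrier G" for w
    using assms that by (intro A.finsum_closed) (auto intro!: A.m_closed)
  then show ?thesis
    by (auto simp: smash_simps)
qed

text \<open>At w both sides become the double sum of \<open>F v u\<close>, where v is the group
  component of the factor from f and u that of the product of the factors from f and g. The two
  bracketings correspond to the two orders of summation.\<close>

lemma smash_assoc:
  assumes f: "f \<in> carrier smash" and g: "g \<in> carrier smash" and h: "h \<in> carrier smash"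
  shows "f \<otimes>\<^bsub>smash\<^esub> g \<otimes>\<^bsub>smash\<^esub> h = f \<otimes>\<^bsub>smash\<^esub> (g \<otimes>\<^bsub>smash\<^esub> h)"
proof (rule smash_eqI)
  fix w assume w: "w \<in> carrier G"
  define F where "F v u = f v \<otimes>\<^bsub>A\<^esub> (act v (g (inv\<^bsub>G\<^esub> v \<otimes>\<^bsub>G\<^esub> u)) \<otimes>\<^bsub>A\<^esub> act u (h (inv\<^bsub>G\<^esub> u \<otimes>\<^bsub>G\<^esub> w)))" for v u
  have F [simp]: "F v u \<in> carrier A" if "v \<in> carrier G" "u \<in> carrier G" for v u
    using that f g h w by (simp add: F_def)
  have "(f \<otimes>\<^bsub>smash\<^esub> g \<otimes>\<^bsub>smash\<^esub> h) w = (\<Oplus>\<^bsub>A\<^esub>u\<in>carrier G. \<Oplus>\<^bsub>A\<^esub>v\<in>carrier G. F v u)"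
  proof -
    have "(\<Oplus>\<^bsub>A\<^esub>v\<in>carrier G. f v \<otimes>\<^bsub>A\<^esub> act v (g (inv\<^bsub>G\<^esub> v \<otimes>\<^bsub>G\<^esub> u))) \<otimes>\<^bsub>A\<^esub> act u (h (inv\<^bsub>G\<^esub> u \<otimes>\<^bsub>G\<^esub> w)) =
        (\<Oplus>\<^bsub>A\<^esub>v\<in>carrier G. F v u)" if "u \<in> carrier G" for u
      using that f g h w
      by (subst A.finsum_ldistr) (auto simp: F_def A.m_assoc intro!: A.finsum_cong')
    then show ?thesis
      using w by (auto simp: smash_simps(6) intro!: A.finsum_cong')
  qed
  also have "\<dots> = (\<Oplus>\<^bsub>A\<^esub>v\<in>carrier G. \<Oplus>\<^bsub>A\<^esub>u\<in>carrier G. F v u)"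
    by (rule A.finsum_swap) auto
  also have "\<dots> = (f \<otimes>\<^bsub>smash\<^esub> (g \<otimes>\<^bsub>smash\<^esub> h)) w"
  proof -
    have "f v \<otimes>\<^bsub>A\<^esub> act v (\<Oplus>\<^bsub>A\<^esub>t\<in>carrier G. g t \<otimes>\<^bsub>A\<^esub> act t (h (inv\<^bsub>G\<^esub> t \<otimes>\<^bsub>G\<^esub> (inv\<^bsub>G\<^esub> v \<otimes>\<^bsub>G\<^esub> w)))) =
        (\<Oplus>\<^bsub>A\<^esub>u\<in>carrier G. F v u)" if v: "v \<in> carrier G" for v
    proof -
      \<comment> \<open>Substitution u = v t, with t the group component of the factor from g; it is
        a bijection of the group, and acting by u is acting by t and then by v.\<close>
      have "(\<Oplus>\<^bsub>A\<^esub>u\<in>carrier G. F v u) = (\<Oplus>\<^bsub>A\<^esub>u\<in>(\<lambda>t. v \<otimes>\<^bsub>G\<^esub> t) ` carrier G. F v u)"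
        using v by (simp add: G.surj_const_mult)
      also have "\<dots> = (\<Oplus>\<^bsub>A\<^esub>t\<in>carrier G. F v (v \<otimes>\<^bsub>G\<^esub> t))"
        using v by (intro A.finsum_reindex) (auto simp: G.inj_on_cmult)
      also have "\<dots> = (\<Oplus>\<^bsub>A\<^esub>t\<in>carrier G.
          f v \<otimes>\<^bsub>A\<^esub> act v (g t \<otimes>\<^bsub>A\<^esub> act t (h (inv\<^bsub>G\<^esub> t \<otimes>\<^bsub>G\<^esub> (inv\<^bsub>G\<^esub> v \<otimes>\<^bsub>G\<^esub> w)))))"
        using v f g h w
        by (auto simp: F_def act_mult G.inv_mult_group G.m_assoc G.inv_solve_left' G.l_inv_ex
            simp flip: G.m_assoc intro!: A.finsum_cong')
      also have "\<dots> = f v \<otimes>\<^bsub>A\<^esub> act v (\<Oplus>\<^bsub>A\<^esub>t\<in>carrier G. g t \<otimes>\<^bsub>A\<^esub> act t (h (inv\<^bsub>G\<^esub> t \<otimes>\<^bsub>G\<^esub> (inv\<^bsub>G\<^esub> v \<otimes>\<^bsub>G\<^esub> w))))"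
        using v f g h w
        by (subst act_finsum; (subst A.finsum_rdistr)?) auto
      finally show ?thesis by simp
    qed
    then show ?thesis
      using w by (auto simp: smash_simps(6) intro!: A.finsum_cong')
  qed
  finally show "(f \<otimes>\<^bsub>smash\<^esub> g \<otimes>\<^bsub>smash\<^esub> h) w = (f \<otimes>\<^bsub>smash\<^esub> (g \<otimes>\<^bsub>smash\<^esub> h)) w" .
qed (use f g h in simp_all)

lemma smash_elem_closed [simp]:
  assumes "a \<in> carrier A"
  shows "smash_elem A G a u \<in> carrier smash"
  using assms by (auto simp: smash_simps smash_elem_def)

lemma smash_elem_mult:
  assumes "u \<in> carrier G" "v \<in> carrier G" "a \<in> carrier A" "b \<in> carrier A"
  shows "smash_elem A G a u \<otimes>\<^bsub>smash\<^esub> smash_elem A G b v =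
    smash_elem A G (a \<otimes>\<^bsub>A\<^esub> act u b) (u \<otimes>\<^bsub>G\<^esub> v)"
proof (rule smash_eqI)
  fix w assume w: "w \<in> carrier G"
  have iff: "inv\<^bsub>G\<^esub> u \<otimes>\<^bsub>G\<^esub> w = v \<longleftrightarrow> w = u \<otimes>\<^bsub>G\<^esub> v"
    using assms w G.inv_solve_left' by (metis G.inv_closed G.inv_inv G.inv_solve_left)
  have "(smash_elem A G a u \<otimes>\<^bsub>smash\<^esub> smash_elem A G b v) w =
    (\<Oplus>\<^bsub>A\<^esub>t\<in>carrier G. if u = t then a \<otimes>\<^bsub>A\<^esub> act t (smash_elem A G b v (inv\<^bsub>G\<^esub> t \<otimes>\<^bsub>G\<^esub> w)) else \<zero>\<^bsub>A\<^esub>)"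
    using assms w by (auto simp: smash_simps(6) smash_elem_def intro!: A.finsum_cong')
  also have "\<dots> = a \<otimes>\<^bsub>A\<^esub> act u (smash_elem A G b v (inv\<^bsub>G\<^esub> u \<otimes>\<^bsub>G\<^esub> w))"
    using assms w by (intro A.finsum_singleton) auto
  also have "\<dots> = smash_elem A G (a \<otimes>\<^bsub>A\<^esub> act u b) (u \<otimes>\<^bsub>G\<^esub> v) w"
    using assms w iff by (auto simp: smash_elem_def)
  finally show "(smash_elem A G a u \<otimes>\<^bsub>smash\<^esub> smash_elem A G b v) w =
    smash_elem A G (a \<otimes>\<^bsub>A\<^esub> act u b) (u \<otimes>\<^bsub>G\<^esub> v) w" .
qed (use assms in simp_all)

lemma smash_one_elem: "\<one>\<^bsub>smash\<^esub> = smash_elem A G \<one>\<^bsub>A\<^esub> \<one>\<^bsub>G\<^esub>"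
  by (simp add: smash_simps smash_elem_def)

lemma smash_elem_add:
  assumes "a \<in> carrier A" "b \<in> carrier A"
  shows "smash_elem A G (a \<oplus>\<^bsub>A\<^esub> b) u = smash_elem A G a u \<oplus>\<^bsub>smash\<^esub> smash_elem A G b u"
  using assms by (auto simp: smash_simps smash_elem_def)

lemma smash_elem_smult:
  assumes "a \<in> carrier A"
  shows "smash_elem A G (z \<odot>\<^bsub>A\<^esub> a) u = z \<odot>\<^bsub>smash\<^esub> smash_elem A G a u"
  using assms by (auto simp: smash_simps smash_elem_def)

lemma smash_mult_one:
  assumes f: "f \<in> carrier smash"
  shows "\<one>\<^bsub>smash\<^esub> \<otimes>\<^bsub>smash\<^esub> f = f" "f \<otimes>\<^bsub>smash\<^esub> \<one>\<^bsub>smash\<^esub> = f"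
proof -
  have one: "\<one>\<^bsub>smash\<^esub> \<in> carrier smash"
    by (simp add: smash_one_elem)
  show "\<one>\<^bsub>smash\<^esub> \<otimes>\<^bsub>smash\<^esub> f = f"
  proof (rule smash_eqI)
    fix w assume w: "w \<in> carrier G"
    have "(\<one>\<^bsub>smash\<^esub> \<otimes>\<^bsub>smash\<^esub> f) w = (\<Oplus>\<^bsub>A\<^esub>t\<in>carrier G. if \<one>\<^bsub>G\<^esub> = t then act t (f (inv\<^bsub>G\<^esub> t \<otimes>\<^bsub>G\<^esub> w)) else \<zero>\<^bsub>A\<^esub>)"
      using f w by (auto simp: smash_simps(2,6) intro!: A.finsum_cong')
    also have "\<dots> = act \<one>\<^bsub>G\<^esub> (f (inv\<^bsub>G\<^esub> \<one>\<^bsub>G\<^esub> \<otimes>\<^bsub>G\<^esub> w))"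
      using f w by (intro A.finsum_singleton) auto
    finally show "(\<one>\<^bsub>smash\<^esub> \<otimes>\<^bsub>smash\<^esub> f) w = f w"
      using f w by simp
  qed (use f one in simp_all)
  show "f \<otimes>\<^bsub>smash\<^esub> \<one>\<^bsub>smash\<^esub> = f"
  proof (rule smash_eqI)
    fix w assume w: "w \<in> carrier G"
    have iff: "inv\<^bsub>G\<^esub> t \<otimes>\<^bsub>G\<^esub> w = \<one>\<^bsub>G\<^esub> \<longleftrightarrow> w = t" if "t \<in> carrier G" for t
      using that w by (metis G.inv_closed G.inv_equality G.inv_inv G.l_inv)
    have "(f \<otimes>\<^bsub>smash\<^esub> \<one>\<^bsub>smash\<^esub>) w = (\<Oplus>\<^bsub>A\<^esub>t\<in>carrier G. if w = t then f t else \<zero>\<^bsub>A\<^esub>)"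
      using f w iff by (auto simp: smash_simps(2,6) intro!: A.finsum_cong')
    also have "\<dots> = f w"
      using f w by (intro A.finsum_singleton) auto
    finally show "(f \<otimes>\<^bsub>smash\<^esub> \<one>\<^bsub>smash\<^esub>) w = f w" .
  qed (use f one in simp_all)
qed

lemma associative_smash_product: "associative_algebra smash"
proof -
  have ag: "abelian_group smash"
  proof (rule abelian_groupI)
    show "\<exists>g\<in>carrier smash. g \<oplus>\<^bsub>smash\<^esub> f = \<zero>\<^bsub>smash\<^esub>" if "f \<in> carrier smash" for f
      using that
      by (intro bexI[of _ "\<lambda>w\<in>carrier G. \<ominus>\<^bsub>A\<^esub> f w"]) (auto simp: smash_simps A.l_neg PiE_mem)
    show "\<zero>\<^bsub>smash\<^esub> \<oplus>\<^bsub>smash\<^esub> f = f" if "f \<in> carrier smash" for f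
      using that by (intro smash_eqI) (auto simp: smash_simps PiE_mem)
  qed (auto simp: smash_simps A.a_ac PiE_mem)
  have add: "f \<oplus>\<^bsub>smash\<^esub> g \<in> carrier smash" and smult: "z \<odot>\<^bsub>smash\<^esub> f \<in> carrier smash"
    if "f \<in> carrier smash" "g \<in> carrier smash" for f g z
    using that by (auto simp: smash_simps PiE_mem)
  have app: "(f \<oplus>\<^bsub>smash\<^esub> g) w = f w \<oplus>\<^bsub>A\<^esub> g w" "(z \<odot>\<^bsub>smash\<^esub> f) w = z \<odot>\<^bsub>A\<^esub> f w"
    "(f \<otimes>\<^bsub>smash\<^esub> g) w = (\<Oplus>\<^bsub>A\<^esub>u\<in>carrier G. f u \<otimes>\<^bsub>A\<^esub> act u (g (inv\<^bsub>G\<^esub> u \<otimes>\<^bsub>G\<^esub> w)))"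
    if "w \<in> carrier G" for f g w z
    using that by (simp_all add: smash_simps)
  \<comment> \<open>Scaling by z is left multiplication by z 1, so distributivity of the ring over
    finite sums applies.\<close>
  have smult_finsum: "z \<odot>\<^bsub>A\<^esub> finsum A f X = (\<Oplus>\<^bsub>A\<^esub>x\<in>X. z \<odot>\<^bsub>A\<^esub> f x)"
    if "finite X" "f \<in> X \<rightarrow> carrier A" for z f and X :: "'g set"
    using A.finsum_rdistr[OF that(1) A.smult_closed[OF A.one_closed] that(2), of z] that(2)
    by (simp add: A.smult_mult_left A.finsum_closed Pi_def cong: A.finsum_cong)
  have ring: "ring smash"
  proof (rule ringI[OF ag])
    show "Group.monoid smash"
      by (rule monoidI) (auto simp: smash_assoc smash_mult_one smash_one_elem[symmetric]
          intro: smash_elem_closed[of "\<one>\<^bsub>A\<^esub>" "\<one>\<^bsub>G\<^esub>", folded smash_one_elem])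
    fix f g h assume fgh: "f \<in> carrier smash" "g \<in> carrier smash" "h \<in> carrier smash"
    show "(f \<oplus>\<^bsub>smash\<^esub> g) \<otimes>\<^bsub>smash\<^esub> h = f \<otimes>\<^bsub>smash\<^esub> h \<oplus>\<^bsub>smash\<^esub> g \<otimes>\<^bsub>smash\<^esub> h"
    proof (rule smash_eqI)
      fix w assume "w \<in> carrier G"
      then show "((f \<oplus>\<^bsub>smash\<^esub> g) \<otimes>\<^bsub>smash\<^esub> h) w = (f \<otimes>\<^bsub>smash\<^esub> h \<oplus>\<^bsub>smash\<^esub> g \<otimes>\<^bsub>smash\<^esub> h) w"
        using fgh
        by (simp add: app Pi_def A.l_distr flip: A.finsum_addf cong: A.finsum_cong)
    qed (use fgh add in simp_all)
    show "h \<otimes>\<^bsub>smash\<^esub> (f \<oplus>\<^bsub>smash\<^esub> g) = h \<otimes>\<^bsub>smash\<^esub> f \<oplus>\<^bsub>smash\<^esub> h \<otimes>\<^bsub>smash\<^esub> g"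
    proof (rule smash_eqI)
      fix w assume "w \<in> carrier G"
      then show "(h \<otimes>\<^bsub>smash\<^esub> (f \<oplus>\<^bsub>smash\<^esub> g)) w = (h \<otimes>\<^bsub>smash\<^esub> f \<oplus>\<^bsub>smash\<^esub> h \<otimes>\<^bsub>smash\<^esub> g) w"
        using fgh
        by (simp add: app Pi_def A.r_distr flip: A.finsum_addf cong: A.finsum_cong)
    qed (use fgh add in simp_all)
  qed
  show ?thesis
  proof (rule associative_algebra.intro[OF ring], rule associative_algebra_axioms.intro)
    fix f g z z' assume f: "f \<in> carrier smash"
    show "z \<odot>\<^bsub>smash\<^esub> f \<in> carrier smash"
      using smult f by blast
    show "(z + z') \<odot>\<^bsub>smash\<^esub> f = z \<odot>\<^bsub>smash\<^esub> f \<oplus>\<^bsub>smash\<^esub> z' \<odot>\<^bsub>smash\<^esub> f"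
      using f by (intro smash_eqI) (auto simp: app A.smult_l_distr smult add)
    show "(z * z') \<odot>\<^bsub>smash\<^esub> f = z \<odot>\<^bsub>smash\<^esub> (z' \<odot>\<^bsub>smash\<^esub> f)"
      using f by (intro smash_eqI) (auto simp: app A.smult_assoc smult add)
    show "1 \<odot>\<^bsub>smash\<^esub> f = f"
      using f by (intro smash_eqI) (auto simp: app smult add)
    assume g: "g \<in> carrier smash"
    show "z \<odot>\<^bsub>smash\<^esub> (f \<oplus>\<^bsub>smash\<^esub> g) = z \<odot>\<^bsub>smash\<^esub> f \<oplus>\<^bsub>smash\<^esub> z \<odot>\<^bsub>smash\<^esub> g"
      using f g by (intro smash_eqI) (auto simp: app A.smult_r_distr smult add)
    show "(z \<odot>\<^bsub>smash\<^esub> f) \<otimes>\<^bsub>smash\<^esub> g = z \<odot>\<^bsub>smash\<^esub> (f \<otimes>\<^bsub>smash\<^esub> g)"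
    proof (rule smash_eqI)
      fix w assume "w \<in> carrier G"
      then show "((z \<odot>\<^bsub>smash\<^esub> f) \<otimes>\<^bsub>smash\<^esub> g) w = (z \<odot>\<^bsub>smash\<^esub> (f \<otimes>\<^bsub>smash\<^esub> g)) w"
        using f g by (simp add: app smult_finsum Pi_def A.smult_mult_left cong: A.finsum_cong)
    qed (use f g smult in simp_all)
    show "f \<otimes>\<^bsub>smash\<^esub> (z \<odot>\<^bsub>smash\<^esub> g) = z \<odot>\<^bsub>smash\<^esub> (f \<otimes>\<^bsub>smash\<^esub> g)"
    proof (rule smash_eqI)
      fix w assume "w \<in> carrier G"
      then show "(f \<otimes>\<^bsub>smash\<^esub> (z \<odot>\<^bsub>smash\<^esub> g)) w = (z \<odot>\<^bsub>smash\<^esub> (f \<otimes>\<^bsub>smash\<^esub> g)) w"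
        using f g by (simp add: app smult_finsum Pi_def A.smult_mult_right cong: A.finsum_cong)
    qed (use f g smult in simp_all)
  qed
qed

end

section \<open>Tensor algebras and the Clifford algebra\<close>

text \<open>The linear extension of a map between basis elements. For \<open>map f\<close> it is the
  operation that \<open>tensor_map f\<close> applies to every member of a coset, isolated here so
  that it can be studied on the free algebra.\<close>

definition pushforward :: "('g \<Rightarrow> 'h) \<Rightarrow> ('g \<Rightarrow>\<^sub>0 'k::comm_monoid_add) \<Rightarrow> 'h \<Rightarrow>\<^sub>0 'k" where
  "pushforward \<phi> p =
     (\<Sum>a\<in>Poly_Mapping.keys p. Poly_Mapping.single (\<phi> a) (Poly_Mapping.lookup p a))"

lemma pushforward_superset:
  assumes "finite A" "Poly_Mapping.keys p \<subseteq> A"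
  shows "pushforward \<phi> p = (\<Sum>a\<in>A. Poly_Mapping.single (\<phi> a) (Poly_Mapping.lookup p a))"
  unfolding pushforward_def using assms
  by (intro sum.mono_neutral_left) (auto simp: in_keys_iff)

lemma pushforward_add: "pushforward \<phi> (p + q) = pushforward \<phi> p + pushforward \<phi> q"
proof -
  note * = pushforward_superset[where A = "Poly_Mapping.keys p \<union> Poly_Mapping.keys q"]
  show ?thesis
    using Poly_Mapping.keys_add[of p q]
    by (simp add: * lookup_add single_add sum.distrib)
qed

lemma pushforward_zero [simp]: "pushforward \<phi> 0 = 0"
  by (simp add: pushforward_def)

lemma pushforward_single [simp]:
  "pushforward \<phi> (Poly_Mapping.single a x) = Poly_Mapping.single (\<phi> a) x"
  by (subst pushforward_superset[where A = "{a}"]) auto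

lemma pushforward_pushforward: "pushforward \<phi> (pushforward \<psi> p) = pushforward (\<phi> \<circ> \<psi>) p"
  using subset_UNIV[of "Poly_Mapping.keys p"]
  by (induction p rule: poly_mapping_additive_induct) (simp_all add: pushforward_add)

lemma pushforward_id [simp]: "pushforward id p = p"
  by (simp add: pushforward_def poly_mapping_sum_single)

lemma pushforward_hom:
  assumes \<phi>: "\<phi> \<in> hom G H" "\<phi> \<one>\<^bsub>G\<^esub> = \<one>\<^bsub>H\<^esub>"
  shows "pushforward \<phi> \<in> algebra_hom (monoid_algebra G) (monoid_algebra H :: ('k::field, 'h \<Rightarrow>\<^sub>0 'k) module)"
proof -
  have smult: "pushforward \<phi> (Poly_Mapping.map ((*) z) p) = Poly_Mapping.map ((*) z) (pushforward \<phi> p)"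
    for z :: 'k and p
    using subset_UNIV[of "Poly_Mapping.keys p"]
    by (induction p rule: poly_mapping_additive_induct)
      (simp_all add: pushforward_add monoid_algebra_smult_add)
  have closed: "Poly_Mapping.keys (pushforward \<phi> p) \<subseteq> carrier H"
    if "Poly_Mapping.keys p \<subseteq> carrier G" for p :: "_ \<Rightarrow>\<^sub>0 'k"
    using that \<phi>
    by (induction p rule: poly_mapping_additive_induct)
      (auto simp add: pushforward_add keys_add_subset hom_def)
  have mult: "pushforward \<phi> (p \<otimes>\<^bsub>monoid_algebra G\<^esub> q) =
      pushforward \<phi> p \<otimes>\<^bsub>monoid_algebra H\<^esub> pushforward \<phi> q"
    if "Poly_Mapping.keys p \<subseteq> carrier G" "Poly_Mapping.keys q \<subseteq> carrier G" for p q :: "_ \<Rightarrow>\<^sub>0 'k"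
    using that
  proof (induction p rule: poly_mapping_additive_induct)
    case (single a x)
    from single(2,1) show ?case
      using \<phi>(1) by (induction q rule: poly_mapping_additive_induct)
        (simp_all add: pushforward_add monoid_algebra_mult_add_right hom_mult)
  qed (simp_all add: pushforward_add monoid_algebra_mult_add_left)
  show ?thesis
    using \<phi>(2) by (auto simp: algebra_hom_def mult smult pushforward_add intro!: ring_hom_memI subsetD[OF closed])
qed

lemma monoid_word_monoid: "Group.monoid word_monoid"
  by (rule monoidI) (auto simp: word_monoid_def)

lemma word_monoid_simps [simp]:
  "carrier word_monoid = UNIV" "l \<otimes>\<^bsub>word_monoid\<^esub> l' = l @ l'" "\<one>\<^bsub>word_monoid\<^esub> = []"
  by (simp_all add: word_monoid_def)

interpretation Free: associative_algebra "monoid_algebra word_monoid :: ('k::field, 'v list \<Rightarrow>\<^sub>0 'k) module"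
  by (rule associative_monoid_algebra[OF monoid_word_monoid])

lemma pushforward_map_hom:
  "pushforward (map f) \<in> algebra_hom (monoid_algebra word_monoid)
     (monoid_algebra word_monoid :: ('k::field, 'v list \<Rightarrow>\<^sub>0 'k) module)"
  by (rule pushforward_hom) (auto simp: hom_def)

text \<open>Words are products of letters, and every element is a linear combination of
  words.\<close>

lemma free_algebra_hom_eqI:
  fixes f g :: "('v list \<Rightarrow>\<^sub>0 'k::field) \<Rightarrow> 'x"
  assumes B: "associative_algebra B"
    and f: "f \<in> algebra_hom (monoid_algebra word_monoid) B"
    and g: "g \<in> algebra_hom (monoid_algebra word_monoid) B"
    and eq: "\<And>v. f (Poly_Mapping.single [v] 1) = g (Poly_Mapping.single [v] 1)"
  shows "f p = g p"
proof -
  note fD = algebra_homD[OF f, simplified] and gD = algebra_homD[OF g, simplified]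
  have word: "f (Poly_Mapping.single l 1) = g (Poly_Mapping.single l 1)" for l
  proof (induction l)
    case (Cons v l)
    have "Poly_Mapping.single (v # l) (1 :: 'k) =
      Poly_Mapping.single [v] 1 \<otimes>\<^bsub>monoid_algebra word_monoid\<^esub> Poly_Mapping.single l 1"
      by simp
    then show ?case
      using Cons eq fD(4) gD(4) by metis
  qed (simp add: fD gD)
  have single: "f (Poly_Mapping.single l z) = g (Poly_Mapping.single l z)" for l z
    using fD(6)[of z "Poly_Mapping.single l 1"] gD(6)[of z "Poly_Mapping.single l 1"] word by simp
  show ?thesis
    using subset_UNIV[of "Poly_Mapping.keys p"]
  proof (induction p rule: poly_mapping_additive_induct)
    case zero
    show ?case
      using algebra_hom_zero[OF Free.associative_algebra_axioms B f]
        algebra_hom_zero[OF Free.associative_algebra_axioms B g] by simp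
  qed (simp_all add: fD gD single)
qed

section \<open>Tensor algebras and the automorphisms induced by linear maps\<close>

context
  fixes sc :: "'k::field \<Rightarrow> 'v::ab_group_add \<Rightarrow> 'v"
begin

lemma linear_relators_carrier: "linear_relators sc \<subseteq> carrier (monoid_algebra word_monoid)"
  by simp

lemma associative_tensor_algebra: "associative_algebra (tensor_algebra sc)"
  unfolding tensor_algebra_def by (rule Free.associative_quotient_algebra[OF linear_relators_carrier])

interpretation T: associative_algebra "tensor_algebra sc"
  by (rule associative_tensor_algebra)

lemmas tensor_algebra_hom =
  Free.quotient_class_simps[OF linear_relators_carrier, folded tensor_algebra_def]

lemma tensor_gen_closed [simp]: "tensor_gen sc v \<in> carrier (tensor_algebra sc)"
  unfolding tensor_gen_def by (rule tensor_algebra_hom(1)) simp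

lemma tensor_algebra_eqI:
  assumes "f - g \<in> linear_relators sc"
  shows "quotient_class (monoid_algebra word_monoid) (linear_relators sc) f =
    quotient_class (monoid_algebra word_monoid) (linear_relators sc) g"
  using assms
  by (intro Free.quotient_class_relator[OF linear_relators_carrier])
    (simp_all add: monoid_algebra_diff[OF monoid_word_monoid])

lemma tensor_gen_add:
  "tensor_gen sc (v + v') = tensor_gen sc v \<oplus>\<^bsub>tensor_algebra sc\<^esub> tensor_gen sc v'"
  unfolding tensor_gen_def
  by (subst tensor_algebra_hom(2)[symmetric]; (intro tensor_algebra_eqI)?)
    (auto simp: linear_relators_def diff_diff_add[symmetric])

lemma tensor_gen_scale:
  "tensor_gen sc (sc z v) = z \<odot>\<^bsub>tensor_algebra sc\<^esub> tensor_gen sc v"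
  unfolding tensor_gen_def
  by (subst tensor_algebra_hom(8)[symmetric]; (intro tensor_algebra_eqI)?)
    (simp, unfold linear_relators_def Let_def monoid_algebra_simps, blast)

lemma tensor_algebra_hom_eqI:
  assumes "associative_algebra B"
    and "f \<in> algebra_hom (tensor_algebra sc) B" "g \<in> algebra_hom (tensor_algebra sc) B"
    and "\<And>v. f (tensor_gen sc v) = g (tensor_gen sc v)" and "a \<in> carrier (tensor_algebra sc)"
  shows "f a = g a"
proof -
  let ?q = "quotient_class (monoid_algebra word_monoid) (linear_relators sc)"
  have q: "?q \<in> algebra_hom (monoid_algebra word_monoid) (tensor_algebra sc)"
    unfolding tensor_algebra_def by (rule Free.quotient_class_hom[OF linear_relators_carrier])
  obtain p where "a = ?q p"
    using assms(5) Free.quotient_algebra_carrier[OF linear_relators_carrier]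
    by (auto simp: tensor_algebra_def)
  then show ?thesis
    using free_algebra_hom_eqI[OF assms(1) algebra_hom_comp[OF q assms(2)] algebra_hom_comp[OF q assms(3)], of p]
      assms(4) by (simp add: tensor_gen_def)
qed

text \<open>By linearity of f, the relator attached to some vectors goes to the relator attached to
  their images.\<close>

lemma pushforward_map_linear_relators:
  assumes "\<And>v v'. f (v + v') = f v + f v'" "\<And>z v. f (sc z v) = sc z (f v)"
  shows "pushforward (map f) ` linear_relators sc \<subseteq> linear_relators sc"
proof -
  have diff: "pushforward (map f) (p - q) = pushforward (map f) p - pushforward (map f) q"
    for p q :: "'v list \<Rightarrow>\<^sub>0 'k"
    using pushforward_add[of "map f" "p - q" q] by (simp add: algebra_simps)
  show ?thesis
    unfolding linear_relators_def Let_def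
    by (auto simp: diff assms) blast+
qed

lemma tensor_map_eq: "tensor_map f = (`) (pushforward (map f))"
  by (simp add: tensor_map_def pushforward_def fun_eq_iff)

lemma tensor_map_comp: "tensor_map f (tensor_map g K) = tensor_map (f \<circ> g) K"
  by (simp add: tensor_map_eq image_image pushforward_pushforward comp_def)

lemma tensor_map_id: "tensor_map id K = K"
  using pushforward_id unfolding tensor_map_eq list.map_id0 by simp

context
  fixes f g
  assumes f: "\<And>v v'. f (v + v') = f v + f v'" "\<And>z v. f (sc z v) = sc z (f v)"
    and g: "\<And>v v'. g (v + v') = g v + g v'" "\<And>z v. g (sc z v) = sc z (g v)"
    and fg: "\<And>v. f (g v) = v"
begin

lemma pushforward_map_inverse:
  "pushforward (map f) (pushforward (map g) p) = (p :: 'v list \<Rightarrow>\<^sub>0 'k)"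
proof -
  have "map f \<circ> map g = id"
    by (auto simp: fun_eq_iff fg map_idI)
  then show ?thesis
    by (simp add: pushforward_pushforward)
qed

text \<open>The right inverse g supplies the second relator-preserving homomorphism that makes
  images of cosets whole cosets.\<close>

lemma tensor_map_hom: "tensor_map f \<in> algebra_hom (tensor_algebra sc) (tensor_algebra sc)"
  unfolding tensor_map_eq tensor_algebra_def
  using pushforward_map_inverse
  by (intro Free.induced_hom_quotient[where h' = "pushforward (map g)"] linear_relators_carrier
      pushforward_map_hom pushforward_map_linear_relators f g) simp_all

lemma tensor_map_gen: "tensor_map f (tensor_gen sc v) = tensor_gen sc (f v)"
proof -
  have "tensor_map f (tensor_gen sc v) =
      quotient_class (monoid_algebra word_monoid) (linear_relators sc)
        (pushforward (map f) (Poly_Mapping.single [v] 1))"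
    unfolding tensor_map_eq tensor_gen_def
    using pushforward_map_inverse
    by (intro Free.hom_image_quotient_class[where h' = "pushforward (map g)"] linear_relators_carrier
        pushforward_map_hom pushforward_map_linear_relators f g) simp_all
  then show ?thesis
    by (simp add: tensor_gen_def)
qed

end

end

section \<open>The Clifford algebra, its sign involution and the Pin group\<close>

interpretation TR: associative_algebra "tensor_algebra scaleR :: (real, ('a::euclidean_space list \<Rightarrow>\<^sub>0 real) set) module"
  by (rule associative_tensor_algebra)

lemma clifford_relators_carrier: "clifford_relators \<subseteq> carrier (tensor_algebra scaleR)"
  by (auto simp: clifford_relators_def Let_def)

lemma associative_real_clifford: "associative_algebra real_clifford"
  unfolding real_clifford_def by (rule TR.associative_quotient_algebra[OF clifford_relators_carrier])

interpretation RC: associative_algebra "real_clifford :: (real, 'a::euclidean_space clifford) module"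
  by (rule associative_real_clifford)

lemma associative_clifford: "associative_algebra clifford"
  unfolding clifford_def by (rule associative_complexified_algebra[OF associative_real_clifford])

interpretation CC: associative_algebra "clifford :: (complex, 'a::euclidean_space clifford \<times> 'a clifford) module"
  by (rule associative_clifford)

lemmas real_clifford_hom =
  TR.quotient_class_simps[OF clifford_relators_carrier, folded real_clifford_def]

lemma clifford_vec_closed [simp]: "clifford_vec y \<in> carrier real_clifford"
  unfolding clifford_vec_def by (intro real_clifford_hom tensor_gen_closed)

lemma clifford_vec_add: "clifford_vec (y + y') = clifford_vec y \<oplus>\<^bsub>real_clifford\<^esub> clifford_vec y'"
  by (simp add: clifford_vec_def tensor_gen_add real_clifford_hom)

lemma clifford_vec_scaleR: "clifford_vec (r *\<^sub>R y) = r \<odot>\<^bsub>real_clifford\<^esub> clifford_vec y"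
  by (simp add: clifford_vec_def tensor_gen_scale real_clifford_hom)

lemma clifford_vec_relation:
  "clifford_vec y \<otimes>\<^bsub>real_clifford\<^esub> clifford_vec y' \<oplus>\<^bsub>real_clifford\<^esub>
     clifford_vec y' \<otimes>\<^bsub>real_clifford\<^esub> clifford_vec y =
   (2 * (y \<bullet> y')) \<odot>\<^bsub>real_clifford\<^esub> \<one>\<^bsub>real_clifford\<^esub>"
proof -
  let ?T = "tensor_algebra scaleR" and ?e = "tensor_gen scaleR"
  have "quotient_class ?T clifford_relators
      (?e y \<otimes>\<^bsub>?T\<^esub> ?e y' \<oplus>\<^bsub>?T\<^esub> ?e y' \<otimes>\<^bsub>?T\<^esub> ?e y) =
    quotient_class ?T clifford_relators ((2 * (y \<bullet> y')) \<odot>\<^bsub>?T\<^esub> \<one>\<^bsub>?T\<^esub>)"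
    by (rule TR.quotient_class_relator[OF clifford_relators_carrier])
      (auto simp: clifford_relators_def Let_def)
  then show ?thesis
    by (simp add: clifford_vec_def real_clifford_hom)
qed

text \<open>Uniqueness descends along the projections from the free algebra to the tensor algebra
  and on to the Clifford algebra, since both are surjective.\<close>

lemma real_clifford_hom_eqI:
  fixes B :: "(real, 'x) module"
  assumes "associative_algebra B" "f \<in> algebra_hom real_clifford B" "g \<in> algebra_hom real_clifford B"
    and "\<And>y. f (clifford_vec y) = g (clifford_vec y)" and "a \<in> carrier real_clifford"
  shows "f a = g a"
proof -
  let ?q = "quotient_class (tensor_algebra scaleR) clifford_relators"
  have q: "?q \<in> algebra_hom (tensor_algebra scaleR) real_clifford"
    unfolding real_clifford_def by (rule TR.quotient_class_hom[OF clifford_relators_carrier])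
  obtain p where "a = ?q p" "p \<in> carrier (tensor_algebra scaleR)"
    using assms(5) TR.quotient_algebra_carrier[OF clifford_relators_carrier]
    by (auto simp: real_clifford_def)
  then show ?thesis
    using tensor_algebra_hom_eqI[OF assms(1) algebra_hom_comp[OF q assms(2)] algebra_hom_comp[OF q assms(3)], of p]
      assms(4) by (simp add: clifford_vec_def)
qed

lemma clifford_vec_uminus: "clifford_vec (- y) = \<ominus>\<^bsub>real_clifford\<^esub> clifford_vec y"
  using clifford_vec_scaleR[of "- 1" y] by (simp add: RC.minus_eq_smult)

text \<open>\<open>clifford_eps\<close> is a choice, so all its properties rest on this existence.
  The map -1 preserves the inner product, hence sends the Clifford relator of y, y' to that of -y,
  -y'; being its own inverse, it induces a bijective homomorphism of the quotient.\<close>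

lemma clifford_eps_exists:
  "\<exists>f. f \<in> algebra_hom real_clifford real_clifford \<and>
     bij_betw f (carrier real_clifford) (carrier real_clifford) \<and>
     (\<forall>y::'a::euclidean_space. f (clifford_vec y) = \<ominus>\<^bsub>real_clifford\<^esub> clifford_vec y)"
proof -
  let ?h = "tensor_map uminus :: ('a list \<Rightarrow>\<^sub>0 real) set \<Rightarrow> ('a list \<Rightarrow>\<^sub>0 real) set"
  let ?T = "tensor_algebra scaleR :: (real, ('a list \<Rightarrow>\<^sub>0 real) set) module"
  have h: "?h \<in> algebra_hom ?T ?T"
    by (rule tensor_map_hom[where g = uminus]) simp_all
  have gen: "?h (tensor_gen scaleR y) = tensor_gen scaleR (- y)" for y
    by (rule tensor_map_gen[where g = uminus]) simp_all
  have inv: "?h (?h a) = a" for a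
    using tensor_map_id[of a] by (simp add: tensor_map_comp comp_def id_def)
  have rel: "?h ` clifford_relators \<subseteq> clifford_relators"
  proof
    fix b assume "b \<in> ?h ` clifford_relators"
    then obtain y y' where b: "b = ?h (tensor_gen scaleR y \<otimes>\<^bsub>?T\<^esub> tensor_gen scaleR y' \<oplus>\<^bsub>?T\<^esub>
        tensor_gen scaleR y' \<otimes>\<^bsub>?T\<^esub> tensor_gen scaleR y \<ominus>\<^bsub>?T\<^esub> (2 * (y \<bullet> y')) \<odot>\<^bsub>?T\<^esub> \<one>\<^bsub>?T\<^esub>)"
      by (auto simp: clifford_relators_def Let_def)
    have "b = tensor_gen scaleR (- y) \<otimes>\<^bsub>?T\<^esub> tensor_gen scaleR (- y') \<oplus>\<^bsub>?T\<^esub>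
        tensor_gen scaleR (- y') \<otimes>\<^bsub>?T\<^esub> tensor_gen scaleR (- y) \<ominus>\<^bsub>?T\<^esub> (2 * (- y \<bullet> - y')) \<odot>\<^bsub>?T\<^esub> \<one>\<^bsub>?T\<^esub>"
      unfolding b
      by (simp add: algebra_homD[OF h] gen
          algebra_hom_diff[OF TR.associative_algebra_axioms TR.associative_algebra_axioms h])
    then show "b \<in> clifford_relators"
      unfolding clifford_relators_def Let_def by blast
  qed
  have "(`) ?h \<in> algebra_hom real_clifford real_clifford"
    unfolding real_clifford_def
    by (rule TR.induced_hom_quotient[OF clifford_relators_carrier h rel h rel inv])
  moreover have "bij_betw ((`) ?h) (carrier real_clifford) (carrier real_clifford)"
    using algebra_homD(2)[OF calculation]
    by (intro bij_betw_byWitness[where f' = "(`) ?h"]) (auto simp: image_image inv)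
  moreover have "?h ` clifford_vec y = \<ominus>\<^bsub>real_clifford\<^esub> clifford_vec y" for y
    using tensor_gen_closed
    unfolding clifford_vec_uminus[symmetric] unfolding clifford_vec_def gen[symmetric]
    by (rule TR.hom_image_quotient_class[OF clifford_relators_carrier h rel h rel inv])
  ultimately show ?thesis
    by blast
qed

lemma clifford_eps:
  "clifford_eps \<in> algebra_hom real_clifford real_clifford"
  "clifford_eps (clifford_vec y) = \<ominus>\<^bsub>real_clifford\<^esub> clifford_vec y"
  using someI_ex[OF clifford_eps_exists] unfolding clifford_eps_def by blast+

text \<open>The square of the chosen map and the identity are homomorphisms that agree on vectors,
  so uniqueness identifies them.\<close>

lemma clifford_eps_eps:
  assumes "a \<in> carrier real_clifford"
  shows "clifford_eps (clifford_eps a) = a"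
proof -
  have id: "id \<in> algebra_hom real_clifford real_clifford"
    by (simp add: algebra_hom_def ring_hom_def)
  have "clifford_eps (clifford_eps (clifford_vec y)) = clifford_vec y" for y :: 'a
    by (simp add: clifford_eps(2)
        algebra_hom_minus[OF associative_real_clifford associative_real_clifford clifford_eps(1)])
  then have "(clifford_eps \<circ> clifford_eps) a = id a"
    by (intro real_clifford_hom_eqI[OF associative_real_clifford
          algebra_hom_comp[OF clifford_eps(1) clifford_eps(1)] id _ assms]) simp
  then show ?thesis by simp
qed

lemma clifford_of_real_simps:
  "a \<in> carrier real_clifford \<Longrightarrow> clifford_of_real a \<in> carrier clifford"
  "a \<in> carrier real_clifford \<Longrightarrow> b \<in> carrier real_clifford \<Longrightarrow>
    clifford_of_real (a \<oplus>\<^bsub>real_clifford\<^esub> b) = clifford_of_real a \<oplus>\<^bsub>clifford\<^esub> clifford_of_real b"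
  "a \<in> carrier real_clifford \<Longrightarrow> b \<in> carrier real_clifford \<Longrightarrow>
    clifford_of_real (a \<otimes>\<^bsub>real_clifford\<^esub> b) = clifford_of_real a \<otimes>\<^bsub>clifford\<^esub> clifford_of_real b"
  "clifford_of_real \<one>\<^bsub>real_clifford\<^esub> = \<one>\<^bsub>clifford\<^esub>"
  "a \<in> carrier real_clifford \<Longrightarrow>
    clifford_of_real (r \<odot>\<^bsub>real_clifford\<^esub> a) = complex_of_real r \<odot>\<^bsub>clifford\<^esub> clifford_of_real a"
  by (simp_all add: clifford_of_real_def clifford_def complexified_algebra_def a_minus_def)

lemma pin_conj:
  assumes \<eta>: "\<eta> \<in> Pin"
  shows "\<eta> \<otimes>\<^bsub>real_clifford\<^esub> (clifford_vec u \<otimes>\<^bsub>real_clifford\<^esub> clifford_vec v) =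
    (clifford_vec (pin_map \<eta> u) \<otimes>\<^bsub>real_clifford\<^esub> clifford_vec (pin_map \<eta> v)) \<otimes>\<^bsub>real_clifford\<^esub> \<eta>"
proof -
  let ?C = real_clifford
  have unit: "\<eta> \<in> Units ?C" and \<eta>C [simp]: "\<eta> \<in> carrier ?C"
    using \<eta> by (auto simp: Pin_def)
  have \<epsilon>C [simp]: "clifford_eps \<eta> \<in> carrier ?C"
    by (rule algebra_homD(2)[OF clifford_eps(1) \<eta>C])
  \<comment> \<open>The definition of \<open>Pin\<close> puts \<open>twisted_conj \<eta> y\<close>
    into the range of \<open>clifford_vec\<close>, so the preimage chosen by \<open>pin_map\<close>
    really maps back to it.\<close>
  have vec: "clifford_vec (pin_map \<eta> y) = twisted_conj \<eta> y" for y
    using \<eta> unfolding pin_map_def by (intro f_inv_into_f) (auto simp: Pin_def)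
  have right: "clifford_vec (pin_map \<eta> y) \<otimes>\<^bsub>?C\<^esub> \<eta> = clifford_eps \<eta> \<otimes>\<^bsub>?C\<^esub> clifford_vec y" for y
    using unit by (simp add: vec twisted_conj_def RC.m_assoc)
  \<comment> \<open>Under \<open>clifford_eps\<close> the vector on each side of
    \<open>right\<close> contributes one sign; the two signs cancel.\<close>
  have left: "clifford_vec (pin_map \<eta> y) \<otimes>\<^bsub>?C\<^esub> clifford_eps \<eta> = \<eta> \<otimes>\<^bsub>?C\<^esub> clifford_vec y" for y
  proof -
    have "\<ominus>\<^bsub>?C\<^esub> (clifford_vec (pin_map \<eta> y) \<otimes>\<^bsub>?C\<^esub> clifford_eps \<eta>) = \<ominus>\<^bsub>?C\<^esub> (\<eta> \<otimes>\<^bsub>?C\<^esub> clifford_vec y)"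
      using arg_cong[OF right, of clifford_eps y]
      by (simp add: algebra_homD[OF clifford_eps(1)] clifford_eps(2) clifford_eps_eps RC.l_minus RC.r_minus)
    then show ?thesis
      by (metis RC.minus_minus RC.m_closed \<epsilon>C \<eta>C clifford_vec_closed)
  qed
  show ?thesis
    \<comment> \<open>On the right-hand side \<open>right\<close> moves \<eta> past the inner vector
      and turns it into \<open>clifford_eps \<eta>\<close>; \<open>left\<close> turns it back into
      \<eta> at the outer vector.\<close>
    by (simp add: RC.m_assoc right) (simp add: left flip: RC.m_assoc)
qed

section \<open>Reflection groups and the Cherednik algebra\<close>

lemma group_orthogonal_group: "group orthogonal_group"
proof (rule groupI)
  fix f :: "'a \<Rightarrow> 'a" assume "f \<in> carrier orthogonal_group"
  then have f: "orthogonal_transformation f"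
    by (simp add: orthogonal_group_def)
  show "\<exists>g\<in>carrier orthogonal_group. g \<otimes>\<^bsub>orthogonal_group\<^esub> f = \<one>\<^bsub>orthogonal_group\<^esub>"
    using orthogonal_transformation_inv[OF f] orthogonal_transformation_inj[OF f]
    by (intro bexI[of _ "inv_into UNIV f"]) (auto simp: orthogonal_group_def)
qed (auto simp: orthogonal_group_def orthogonal_transformation_compose comp_assoc
    orthogonal_transformation_id[unfolded id_def[symmetric]])

lemma orthogonal_reflection: "orthogonal_transformation (reflection \<alpha>)"
proof -
  define a where "a = adjoint (blinfun_apply \<alpha>) 1"
  have \<alpha>: "blinfun_apply \<alpha> y = y \<bullet> a" for y
    using adjoint_works[of "blinfun_apply \<alpha>" y 1] blinfun.bounded_linear_right[of \<alpha>]
    by (simp add: a_def bounded_linear.linear)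
  have refl: "reflection \<alpha> = (\<lambda>y. y - (2 * (y \<bullet> a) / (a \<bullet> a)) *\<^sub>R a)"
    by (simp add: fun_eq_iff reflection_def coroot_def Let_def \<alpha> flip: a_def)
  have "linear (reflection \<alpha>)"
    unfolding refl by (intro linearI) (simp_all add: algebra_simps add_divide_distrib)
  \<comment> \<open>For a = 0 division by zero gives 0 and the formula is the identity, so the
    statement covers every functional, not only roots.\<close>
  moreover have "reflection \<alpha> y \<bullet> reflection \<alpha> z = y \<bullet> z" for y z
    unfolding refl by (cases "a = 0") (simp_all add: inner_diff_left inner_diff_right field_simps inner_commute)
  ultimately show ?thesis
    by (simp add: orthogonal_transformation_def)
qed

lemma orthogonal_inv:
  fixes w :: "'a::euclidean_space \<Rightarrow> 'a"
  assumes "orthogonal_transformation w"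
  shows "w (inv_into UNIV w y) = y" "inv_into UNIV w (w y) = y"
  using assms
  by (simp_all add: surj_f_inv_f[OF orthogonal_transformation_surj] inv_f_f[OF orthogonal_transformation_inj])

text \<open>\<open>Blinfun\<close> returns the intended functional only for bounded linear maps. The
  inverse of an isometry is linear, and linear maps are bounded in finite dimension.\<close>

lemma dual_act_apply:
  assumes "orthogonal_transformation w"
  shows "blinfun_apply (dual_act w x) y = blinfun_apply x (inv_into UNIV w y)"
proof -
  have "linear (inv_into UNIV w)"
    using orthogonal_transformation_inv[OF assms] by (rule orthogonal_transformation_linear)
  then have "bounded_linear (\<lambda>y. blinfun_apply x (inv_into UNIV w y))"
    by (intro bounded_linear_compose[OF blinfun.bounded_linear_right] linear_conv_bounded_linear[THEN iffD1])
  then show ?thesis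
    by (simp add: dual_act_def bounded_linear_Blinfun_apply)
qed

lemma dual_act_linear:
  assumes "orthogonal_transformation w"
  shows "dual_act w (x + x') = dual_act w x + dual_act w x'"
    "dual_act w (x - x') = dual_act w x - dual_act w x'"
    "dual_act w (r *\<^sub>R x) = r *\<^sub>R dual_act w x"
    "dual_act w 0 = 0"
  by (rule blinfun_eqI; simp add: dual_act_apply[OF assms] blinfun.bilinear_simps)+

lemma dual_act_comp:
  assumes w: "orthogonal_transformation w" and w': "orthogonal_transformation w'"
  shows "dual_act (w \<circ> w') x = dual_act w (dual_act w' x)"
proof -
  have "inv_into UNIV (w \<circ> w') = inv_into UNIV w' \<circ> inv_into UNIV w"
    using w w' by (intro o_inv_distrib) (simp_all add: orthogonal_transformation_bij)
  then show ?thesis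
    by (intro blinfun_eqI)
      (simp add: dual_act_apply w w' orthogonal_transformation_compose)
qed

lemma dual_act_id [simp]: "dual_act id x = x"
  by (rule blinfun_eqI)
    (simp add: dual_act_apply orthogonal_transformation_id[unfolded id_def[symmetric]])

text \<open>Orthogonality gives \<open>B(u, w\<^sup>-\<^sup>1 y) = B(w u, y)\<close>. Thus the
  identification of E with its dual is equivariant, and the generators x(u) and y(u) transform by
  the same rule.\<close>

lemma dual_act_inner:
  assumes "orthogonal_transformation w"
  shows "dual_act w (blinfun_inner_right u) = blinfun_inner_right (w u)"
proof (rule blinfun_eqI)
  fix y
  have "w u \<bullet> w (inv_into UNIV w y) = u \<bullet> inv_into UNIV w y"
    using assms by (simp add: orthogonal_transformation_def)
  then show "blinfun_apply (dual_act w (blinfun_inner_right u)) y = blinfun_apply (blinfun_inner_right (w u)) y"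
    by (simp add: dual_act_apply[OF assms] orthogonal_inv[OF assms])
qed

lemma hh_act_linear:
  assumes "orthogonal_transformation w"
  shows "hh_act w (v + v') = hh_act w v + hh_act w v'"
    and "hh_act w (hh_scale z v) = hh_scale z (hh_act w v)"
proof -
  note lin = orthogonal_transformation_linear[OF assms]
  note simps = hh_act_def hh_scale_def complex_scale_def dual_act_linear[OF assms] linear_add[OF lin]
    linear_diff[OF lin] linear_scale[OF lin]
  show "hh_act w (v + v') = hh_act w v + hh_act w v'"
    by (cases v; cases v') (auto simp: simps)
  show "hh_act w (hh_scale z v) = hh_scale z (hh_act w v)"
    by (cases v) (auto simp: simps)
qed

lemma hh_act_comp:
  assumes "orthogonal_transformation w" "orthogonal_transformation w'"
  shows "hh_act (w \<circ> w') = hh_act w \<circ> hh_act w'"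
  by (auto simp: fun_eq_iff hh_act_def dual_act_comp[OF assms])

lemma hh_act_id: "hh_act id = id"
  by (auto simp: fun_eq_iff hh_act_def)

section \<open>The reflection group and its smash product with the tensor algebra\<close>

locale reflection_group =
  fixes W :: "('a::euclidean_space \<Rightarrow> 'a) set" and R :: "'a dual set"
  assumes reflection_group: "reflection_group_with_roots W R"
begin

lemma subgroup_W: "subgroup W orthogonal_group"
proof -
  have "reflection ` R \<subseteq> carrier orthogonal_group"
    by (auto simp: orthogonal_group_def orthogonal_reflection)
  then show ?thesis
    using group.generate_is_subgroup[OF group_orthogonal_group] reflection_group
    by (simp add: reflection_group_with_roots_def)
qed

lemma orthogonal_W: "w \<in> W \<Longrightarrow> orthogonal_transformation w"
  using subgroup.subset[OF subgroup_W] by (auto simp: orthogonal_group_def)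

lemma weyl_group_simps [simp]:
  "carrier (weyl_group W) = W" "w \<otimes>\<^bsub>weyl_group W\<^esub> w' = w \<circ> w'" "\<one>\<^bsub>weyl_group W\<^esub> = id"
  by (simp_all add: weyl_group_def orthogonal_group_def)

lemma group_weyl_group: "group (weyl_group W)"
  unfolding weyl_group_def by (rule subgroup.subgroup_is_group[OF subgroup_W group_orthogonal_group])

lemma id_W [simp]: "id \<in> W"
  using group.is_monoid[OF group_weyl_group, THEN monoid.one_closed] by simp

lemma inv_W:
  assumes "w \<in> W"
  shows "\<exists>w'\<in>W. w' \<circ> w = id \<and> w \<circ> w' = id"
  using group.l_inv[OF group_weyl_group, of w] group.r_inv[OF group_weyl_group, of w]
    group.inv_closed[OF group_weyl_group, of w] assms
  by auto

lemma tensor_map_hh_act: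
  assumes "w \<in> W"
  shows "tensor_map (hh_act w) \<in> algebra_hom (tensor_algebra hh_scale) (tensor_algebra hh_scale)"
    and "tensor_map (hh_act w) (tensor_gen hh_scale v) = tensor_gen hh_scale (hh_act w v)"
proof -
  \<comment> \<open>The inverse of w in W provides the linear right inverse required by
    \<open>tensor_map_hom\<close> and \<open>tensor_map_gen\<close>.\<close>
  obtain w' where w': "w' \<in> W" "w \<circ> w' = id"
    using inv_W[OF assms] by blast
  have "hh_act w (hh_act w' v) = v" for v
    using hh_act_comp[OF orthogonal_W[OF assms] orthogonal_W[OF w'(1)]] w'(2) hh_act_id
    by (metis comp_apply id_apply)
  note * = hh_act_linear[OF orthogonal_W[OF assms]] hh_act_linear[OF orthogonal_W[OF w'(1)]] this
  show "tensor_map (hh_act w) \<in> algebra_hom (tensor_algebra hh_scale) (tensor_algebra hh_scale)"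
    by (rule tensor_map_hom[OF *])
  show "tensor_map (hh_act w) (tensor_gen hh_scale v) = tensor_gen hh_scale (hh_act w v)"
    by (rule tensor_map_gen[OF *])
qed

sublocale T: associative_algebra "tensor_algebra (hh_scale :: complex \<Rightarrow> 'a hh \<Rightarrow> 'a hh)"
  by (rule associative_tensor_algebra)

sublocale G: group "weyl_group W"
  by (rule group_weyl_group)

sublocale smash_product_algebra "tensor_algebra (hh_scale :: complex \<Rightarrow> 'a hh \<Rightarrow> 'a hh)" "weyl_group W"
  "\<lambda>w. tensor_map (hh_act w)"
proof
  show "finite (carrier (weyl_group W))"
    using reflection_group unfolding weyl_group_simps reflection_group_with_roots_def by blast
qed (simp_all add: tensor_map_hh_act hh_act_id tensor_map_id tensor_map_comp hh_act_comp orthogonal_W)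

sublocale S: associative_algebra "hh_smash W"
  unfolding hh_smash_def by (rule associative_smash_product)

lemma smash_generators_closed [simp]:
  "smash_x W x \<in> carrier (hh_smash W)" "smash_y W y \<in> carrier (hh_smash W)"
  "smash_w W w \<in> carrier (hh_smash W)"
  by (simp_all add: smash_x_def smash_y_def smash_w_def hh_smash_def)

lemma cherednik_relators_carrier: "cherednik_relators W Rp c \<subseteq> carrier (hh_smash W)"
proof -
  have "commutator (hh_smash W) a b \<in> carrier (hh_smash W)"
    if "a \<in> carrier (hh_smash W)" "b \<in> carrier (hh_smash W)" for a b
    using that by (simp add: commutator_def)
  moreover have "(\<Oplus>\<^bsub>hh_smash W\<^esub>\<alpha>\<in>Rp. k \<alpha> \<odot>\<^bsub>hh_smash W\<^esub> smash_w W (reflection \<alpha>)) \<in> carrier (hh_smash W)" for k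
    by (intro S.finsum_closed) auto
  ultimately show ?thesis
    unfolding cherednik_relators_def Let_def by auto
qed

lemma associative_cherednik_algebra: "associative_algebra (cherednik_algebra W Rp c)"
  unfolding cherednik_algebra_def
  by (rule S.associative_quotient_algebra[OF cherednik_relators_carrier])

lemmas cherednik_hom =
  S.quotient_class_simps[OF cherednik_relators_carrier, folded cherednik_algebra_def]

text \<open>In a smash product (1 # w)(x # 1) = w(x) # w = (w(x) # 1)(1 # w); for x = x(u)
  equivariance gives w(x) = x(w u).\<close>

lemma smash_w_x:
  assumes "w \<in> W"
  shows "smash_w W w \<otimes>\<^bsub>hh_smash W\<^esub> smash_x W (blinfun_inner_right u, 0) =
    smash_x W (blinfun_inner_right (w u), 0) \<otimes>\<^bsub>hh_smash W\<^esub> smash_w W w"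
  using assms linear_0[OF orthogonal_transformation_linear[OF orthogonal_W[OF assms]]]
  by (simp add: smash_w_def smash_x_def hh_smash_def smash_elem_mult tensor_map_hh_act)
    (simp add: hh_act_def orthogonal_W dual_act_inner dual_act_linear zero_prod_def)

lemma smash_w_y:
  assumes "w \<in> W"
  shows "smash_w W w \<otimes>\<^bsub>hh_smash W\<^esub> smash_y W (u, 0) =
    smash_y W (w u, 0) \<otimes>\<^bsub>hh_smash W\<^esub> smash_w W w"
  using assms linear_0[OF orthogonal_transformation_linear[OF orthogonal_W[OF assms]]]
  by (simp add: smash_w_def smash_y_def hh_smash_def smash_elem_mult tensor_map_hh_act)
    (simp add: hh_act_def orthogonal_W dual_act_linear zero_prod_def)

lemma smash_w_w:
  assumes "w \<in> W" "w' \<in> W"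
  shows "smash_w W w \<otimes>\<^bsub>hh_smash W\<^esub> smash_w W w' = smash_w W (w \<circ> w')"
  using assms by (simp add: smash_w_def hh_smash_def smash_elem_mult algebra_homD[OF tensor_map_hh_act(1)])

lemma smash_w_id: "smash_w W id = \<one>\<^bsub>hh_smash W\<^esub>"
  by (simp add: smash_w_def hh_smash_def smash_one_elem)

lemma smash_x_linear:
  "smash_x W (x + x') = smash_x W x \<oplus>\<^bsub>hh_smash W\<^esub> smash_x W x'"
  "smash_x W (complex_scale z x) = z \<odot>\<^bsub>hh_smash W\<^esub> smash_x W x"
  using tensor_gen_add[of hh_scale "(x, 0)" "(x', 0)"] tensor_gen_scale[of hh_scale z "(x, 0)"]
  by (simp_all add: smash_x_def hh_smash_def smash_elem_add smash_elem_smult hh_scale_def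
      complex_scale_def zero_prod_def)

lemma smash_y_linear:
  "smash_y W (y + y') = smash_y W y \<oplus>\<^bsub>hh_smash W\<^esub> smash_y W y'"
  "smash_y W (complex_scale z y) = z \<odot>\<^bsub>hh_smash W\<^esub> smash_y W y"
  using tensor_gen_add[of hh_scale "(0, y)" "(0, y')"] tensor_gen_scale[of hh_scale z "(0, y)"]
  by (simp_all add: smash_y_def hh_smash_def smash_elem_add smash_elem_smult hh_scale_def
      complex_scale_def zero_prod_def)

end

section \<open>Angular momenta in the Cherednik algebra for arbitrary vectors\<close>

locale cherednik_data = reflection_group W R
  for W :: "('a::euclidean_space \<Rightarrow> 'a) set" and R :: "'a dual set" +
  fixes Rp :: "'a dual set" and c :: "'a dual \<Rightarrow> complex"
begin

abbreviation H where "H \<equiv> cherednik_algebra W Rp c"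

sublocale H: associative_algebra H
  by (rule associative_cherednik_algebra)

abbreviation X where "X u \<equiv> cherednik_x W Rp c (blinfun_inner_right u, 0)"
abbreviation Y where "Y u \<equiv> cherednik_y W Rp c (u, 0)"
abbreviation w_elem where "w_elem \<equiv> cherednik_w W Rp c"

text \<open>Allowing arbitrary vectors makes M bilinear over the reals; the generators attached to
  any basis are values of this one map.\<close>

definition M where "M u v = X u \<otimes>\<^bsub>H\<^esub> Y v \<ominus>\<^bsub>H\<^esub> X v \<otimes>\<^bsub>H\<^esub> Y u"

lemma angular_momentum_eq: "angular_momentum W Rp c y i j = M (y i) (y j)"
  by (simp add: angular_momentum_def M_def Let_def)

lemma XY_closed [simp]: "X u \<in> carrier H" "Y u \<in> carrier H" "w_elem w \<in> carrier H"
  by (simp_all add: cherednik_x_def cherednik_y_def cherednik_w_def cherednik_hom)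

lemma M_closed [simp]: "M u v \<in> carrier H"
  by (simp add: M_def)

lemma blinfun_inner_right_linear:
  "blinfun_inner_right (u + v) = blinfun_inner_right u + blinfun_inner_right v"
  "blinfun_inner_right (r *\<^sub>R u) = r *\<^sub>R blinfun_inner_right u"
  by (rule blinfun_eqI; simp add: blinfun.bilinear_simps inner_add_left)+

lemma XY_add: "X (u + v) = X u \<oplus>\<^bsub>H\<^esub> X v" "Y (u + v) = Y u \<oplus>\<^bsub>H\<^esub> Y v"
  using smash_x_linear(1)[of "(blinfun_inner_right u, 0)" "(blinfun_inner_right v, 0)"]
    smash_y_linear(1)[of "(u, 0)" "(v, 0)"]
  by (simp_all add: cherednik_x_def cherednik_y_def blinfun_inner_right_linear cherednik_hom)

lemma XY_scale:
  "X (r *\<^sub>R u) = complex_of_real r \<odot>\<^bsub>H\<^esub> X u" "Y (r *\<^sub>R u) = complex_of_real r \<odot>\<^bsub>H\<^esub> Y u"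
  using smash_x_linear(2)[of "complex_of_real r" "(blinfun_inner_right u, 0)"]
    smash_y_linear(2)[of "complex_of_real r" "(u, 0)"]
  by (simp_all add: cherednik_x_def cherednik_y_def blinfun_inner_right_linear cherednik_hom
      complex_scale_def)

lemma w_elem_X: "w \<in> W \<Longrightarrow> w_elem w \<otimes>\<^bsub>H\<^esub> X u = X (w u) \<otimes>\<^bsub>H\<^esub> w_elem w"
  using smash_w_x by (simp add: cherednik_x_def cherednik_w_def flip: cherednik_hom(3))

lemma w_elem_Y: "w \<in> W \<Longrightarrow> w_elem w \<otimes>\<^bsub>H\<^esub> Y u = Y (w u) \<otimes>\<^bsub>H\<^esub> w_elem w"
  using smash_w_y by (simp add: cherednik_y_def cherednik_w_def flip: cherednik_hom(3))

lemma w_elem_mult: "w \<in> W \<Longrightarrow> w' \<in> W \<Longrightarrow> w_elem w \<otimes>\<^bsub>H\<^esub> w_elem w' = w_elem (w \<circ> w')"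
  using smash_w_w by (simp add: cherednik_w_def flip: cherednik_hom(3))

lemma w_elem_id: "w_elem id = \<one>\<^bsub>H\<^esub>"
  by (simp add: cherednik_w_def smash_w_id cherednik_hom)

text \<open>The relations of w with X and Y hold in the smash product and pass to its quotient; w is
  moved past the two factors in turn.\<close>

lemma w_elem_M:
  assumes "w \<in> W"
  shows "w_elem w \<otimes>\<^bsub>H\<^esub> M u v = M (w u) (w v) \<otimes>\<^bsub>H\<^esub> w_elem w"
proof -
  have "w_elem w \<otimes>\<^bsub>H\<^esub> (X u \<otimes>\<^bsub>H\<^esub> Y v) = (X (w u) \<otimes>\<^bsub>H\<^esub> Y (w v)) \<otimes>\<^bsub>H\<^esub> w_elem w" for u v
  proof -
    have "w_elem w \<otimes>\<^bsub>H\<^esub> (X u \<otimes>\<^bsub>H\<^esub> Y v) = X (w u) \<otimes>\<^bsub>H\<^esub> (w_elem w \<otimes>\<^bsub>H\<^esub> Y v)"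
      using w_elem_X[OF assms, of u] by (simp flip: H.m_assoc)
    then show ?thesis
      using w_elem_Y[OF assms, of v] by (simp add: H.m_assoc)
  qed
  then show ?thesis
    by (simp add: M_def a_minus_def H.l_distr H.r_distr H.l_minus H.r_minus)
qed

lemma M_add:
  "M (u + u') v = M u v \<oplus>\<^bsub>H\<^esub> M u' v" "M u (v + v') = M u v \<oplus>\<^bsub>H\<^esub> M u v'"
  by (simp_all add: M_def XY_add a_minus_def H.l_distr H.r_distr H.minus_add H.a_ac)

lemma M_scale:
  "M (r *\<^sub>R u) v = complex_of_real r \<odot>\<^bsub>H\<^esub> M u v" "M u (r *\<^sub>R v) = complex_of_real r \<odot>\<^bsub>H\<^esub> M u v"
  by (simp_all add: M_def XY_scale a_minus_def H.smult_mult_left H.smult_mult_right H.smult_r_distr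
      H.smult_minus_right)

lemma M_self: "M u u = \<zero>\<^bsub>H\<^esub>"
  by (simp add: M_def a_minus_def H.r_neg)

lemma M_swap: "M v u = \<ominus>\<^bsub>H\<^esub> M u v"
  by (simp add: M_def a_minus_def H.minus_add H.a_ac)

text \<open>Generators for all pairs of vectors make this algebra visibly independent of a basis, so
  it can serve as the common value of \<open>angular_momentum_algebra\<close>.\<close>

definition "AMA = generated_subalgebra H (w_elem ` W \<union> {M u v | u v. True})"

lemma AMA_generators_carrier: "w_elem ` W \<union> {M u v | u v. True} \<subseteq> carrier H"
  by auto

sublocale AMA: associative_algebra AMA
  unfolding AMA_def by (rule H.associative_generated_subalgebra[OF AMA_generators_carrier])

lemma AMA_simps [simp]:
  "mult AMA = mult H" "one AMA = one H" "add AMA = add H" "zero AMA = zero H" "smult AMA = smult H"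
  by (simp_all add: AMA_def)

lemma AMA_closed [simp]: "M u v \<in> carrier AMA" "w \<in> W \<Longrightarrow> w_elem w \<in> carrier AMA"
  unfolding AMA_def by (rule subsetD[OF H.generated_subalgebra_self]; blast)+

text \<open>By bilinearity, a subspace that contains all \<open>M (y i) (y j)\<close> with \<open>i < j\<close> contains every \<open>M u v\<close>.\<close>

lemma angular_momentum_algebra_eq:
  assumes y: "orthonormal_basis y"
  shows "angular_momentum_algebra W Rp c y = AMA"
proof -
  let ?M = "(\<lambda>(i, j). angular_momentum W Rp c y i j) ` index_pairs DIM('a)"
  \<comment> \<open>A generated subalgebra is an intersection, so it suffices that the two
    generating sets are contained in the same subalgebras T.\<close>
  have "w_elem ` W \<union> ?M \<subseteq> T \<longleftrightarrow> w_elem ` W \<union> {M u v | u v. True} \<subseteq> T"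
    if T: "subring T H" "\<forall>z. \<forall>a\<in>T. z \<odot>\<^bsub>H\<^esub> a \<in> T" for T
  proof
    assume *: "w_elem ` W \<union> {M u v | u v. True} \<subseteq> T"
    then have "M u v \<in> T" for u v
      by blast
    then show "w_elem ` W \<union> ?M \<subseteq> T"
      using * by (auto simp: angular_momentum_eq)
  next
    assume gen: "w_elem ` W \<union> ?M \<subseteq> T"
    have less: "M (y i) (y j) \<in> T" if "i \<in> {1..DIM('a)}" "j \<in> {1..DIM('a)}" "i < j" for i j
      using gen that by (auto simp: angular_momentum_eq index_pairs_def)
    have all: "M (y i) (y j) \<in> T" if ij: "i \<in> {1..DIM('a)}" "j \<in> {1..DIM('a)}" for i j
    proof (cases i j rule: linorder_cases)
      case greater
      then have "\<ominus>\<^bsub>H\<^esub> M (y j) (y i) \<in> T"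
        using less ij subringE(5)[OF T(1)] by blast
      then show ?thesis
        using M_swap by metis
    qed (use ij less M_self subringE(2)[OF T(1)] in simp_all)
    have span: "u \<in> span (y ` {1..DIM('a)})" for u
      using y by (simp add: orthonormal_basis_def)
    \<comment> \<open>Starts both span inductions: by bilinearity, M with a zero argument is 0 times
      itself.\<close>
    have zero: "0 \<odot>\<^bsub>H\<^esub> M u v \<in> T" for u v
      using subringE(2)[OF T(1)] by simp
    \<comment> \<open>Linearity is used in one argument at a time, here with a basis vector kept in
      the second.\<close>
    have right: "M u (y j) \<in> T" if "j \<in> {1..DIM('a)}" for u j
      using span[of u]
    proof (induction u rule: span_induct_alt)
      case base
      then show ?case using zero[of 0 "y j"] M_scale(1)[of 0 0] by simp
    next
      case (step r x u)
      then show ?case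
        using T all that subringE(7)[OF T(1)] by (auto simp: M_add M_scale)
    qed
    have "M u v \<in> T" for u v
      using span[of v]
    proof (induction v rule: span_induct_alt)
      case base
      then show ?case using zero[of u 0] M_scale(2)[of u 0] by simp
    next
      case (step r x v)
      then show ?case
        using T right subringE(7)[OF T(1)] by (auto simp: M_add M_scale)
    qed
    then show "w_elem ` W \<union> {M u v | u v. True} \<subseteq> T"
      using gen by auto
  qed
  then have "{T. subring T H \<and> (\<forall>z. \<forall>a\<in>T. z \<odot>\<^bsub>H\<^esub> a \<in> T) \<and> w_elem ` W \<union> ?M \<subseteq> T} =
      {T. subring T H \<and> (\<forall>z. \<forall>a\<in>T. z \<odot>\<^bsub>H\<^esub> a \<in> T) \<and> w_elem ` W \<union> {M u v | u v. True} \<subseteq> T}"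
    by (intro Collect_cong conj_cong refl)
  then show ?thesis
    unfolding angular_momentum_algebra_def AMA_def generated_subalgebra_def
    by (rule arg_cong[where f = "\<lambda>X. H\<lparr>carrier := \<Inter>X\<rparr>"])
qed

end

section \<open>Traces and the AMA-Dirac element\<close>

text \<open>The difference of the two sides is orthogonal to a spanning set, hence to
  itself.\<close>

lemma orthonormal_basis_expand:
  fixes y :: "nat \<Rightarrow> 'a::euclidean_space"
  assumes y: "orthonormal_basis y"
  shows "(\<Sum>i\<in>{1..DIM('a)}. (x \<bullet> y i) *\<^sub>R y i) = x"
proof -
  let ?z = "(\<Sum>i\<in>{1..DIM('a)}. (x \<bullet> y i) *\<^sub>R y i) - x"
  have "?z \<bullet> y j = 0" if j: "j \<in> {1..DIM('a)}" for j
  proof -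
    have "(\<Sum>i\<in>{1..DIM('a)}. (x \<bullet> y i) *\<^sub>R y i) \<bullet> y j = (\<Sum>i\<in>{1..DIM('a)}. if i = j then x \<bullet> y j else 0)"
      using y j unfolding inner_sum_left orthonormal_basis_def
      by (intro sum.cong) auto
    then show ?thesis
      using j by (simp add: inner_diff_left)
  qed
  then have "orthogonal ?z b" if "b \<in> y ` {1..DIM('a)}" for b
    using that by (auto simp: orthogonal_def)
  then have "orthogonal ?z ?z"
    using orthogonal_to_span[of ?z "y ` {1..DIM('a)}" ?z] y
    by (auto simp: orthonormal_basis_def)
  then show ?thesis
    by (simp add: orthogonal_self)
qed

lemma orthonormal_basis_orthogonal_image:
  fixes y :: "nat \<Rightarrow> 'a::euclidean_space" and w :: "'a \<Rightarrow> 'a"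
  assumes "orthonormal_basis y" "orthogonal_transformation w"
  shows "orthonormal_basis (\<lambda>i. w (y i))"
proof -
  have "span ((\<lambda>i. w (y i)) ` {1..DIM('a)}) = w ` span (y ` {1..DIM('a)})"
    using linear_span_image[OF orthogonal_transformation_linear[OF assms(2)], of "y ` {1..DIM('a)}"]
    by (simp add: image_image)
  then show ?thesis
    using assms orthogonal_transformation_surj[OF assms(2)]
    by (auto simp: orthonormal_basis_def orthogonal_transformation_def)
qed

section \<open>Traces and symmetric double sums in an abelian group\<close>

context abelian_group
begin

text \<open>Links the sum of vectors in the type to \<open>finsum\<close> in the group record. For
  infinite I both sums take their default value zero.\<close>

lemma hom_sum:
  assumes closed: "\<And>x. f x \<in> carrier G" and add: "\<And>x y :: 'v::ab_group_add. f (x + y) = f x \<oplus> f y"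
  shows "f (sum g I) = (\<Oplus>i\<in>I. f (g i))"
proof -
  have zero: "f 0 = \<zero>"
    using add[of 0 0] closed[of 0] by (simp add: add.l_cancel_one')
  show ?thesis
  proof (cases "finite I")
    case True
    then show ?thesis
      by (induction I rule: finite_induct) (simp_all add: zero add closed)
  qed (simp add: zero)
qed

text \<open>Expand the first argument \<open>y i\<close> in the basis y', move the coefficients to
  the second argument, and sum over i: by symmetry of the inner product the second argument becomes
  \<open>y' k\<close>. The hypothesis \<open>balanced\<close> stands in for homogeneity, which a
  bare abelian group cannot express; it says that F factors through the tensor square of the space
  over the reals.\<close>

lemma orthonormal_trace_eq:
  fixes y y' :: "nat \<Rightarrow> 'v::euclidean_space"
  assumes y: "orthonormal_basis y" and y': "orthonormal_basis y'"
    and closed: "\<And>u v. F u v \<in> carrier G"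
    and add_left: "\<And>u u' v. F (u + u') v = F u v \<oplus> F u' v"
    and add_right: "\<And>u v v'. F u (v + v') = F u v \<oplus> F u v'"
    and balanced: "\<And>r u v. F (r *\<^sub>R u) v = F u (r *\<^sub>R v)"
  shows "(\<Oplus>i\<in>{1..DIM('v)}. F (y i) (y i)) = (\<Oplus>i\<in>{1..DIM('v)}. F (y' i) (y' i))"
proof -
  let ?I = "{1..DIM('v)}"
  have inner: "(\<Oplus>i\<in>?I. F (y' k) ((y' k \<bullet> y i) *\<^sub>R y i)) = F (y' k) (y' k)" for k
    using hom_sum[of "F (y' k)", OF closed add_right, of "\<lambda>i. (y' k \<bullet> y i) *\<^sub>R y i" ?I]
    by (simp only: orthonormal_basis_expand[OF y])
  have "F (y i) (y i) = (\<Oplus>k\<in>?I. F ((y i \<bullet> y' k) *\<^sub>R y' k) (y i))" for i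
    using hom_sum[of "\<lambda>u. F u (y i)", OF closed add_left, of "\<lambda>k. (y i \<bullet> y' k) *\<^sub>R y' k" ?I]
    by (simp only: orthonormal_basis_expand[OF y'])
  then have "(\<Oplus>i\<in>?I. F (y i) (y i)) = (\<Oplus>i\<in>?I. \<Oplus>k\<in>?I. F (y' k) ((y i \<bullet> y' k) *\<^sub>R y i))"
    by (simp only: balanced)
  also have "\<dots> = (\<Oplus>k\<in>?I. \<Oplus>i\<in>?I. F (y' k) ((y' k \<bullet> y i) *\<^sub>R y i))"
    by (subst finsum_swap) (simp_all add: closed inner_commute)
  finally show ?thesis
    by (simp only: inner)
qed

lemma finsum_Times:
  assumes "finite X" "finite Y" "\<And>a b. a \<in> X \<Longrightarrow> b \<in> Y \<Longrightarrow> f (a, b) \<in> carrier G"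
  shows "(\<Oplus>p\<in>X \<times> Y. f p) = (\<Oplus>a\<in>X. \<Oplus>b\<in>Y. f (a, b))"
  using assms(1,3)
proof (induction X rule: finite_induct)
  case (insert x X)
  have "insert x X \<times> Y = Pair x ` Y \<union> X \<times> Y"
    by auto
  then have "(\<Oplus>p\<in>insert x X \<times> Y. f p) = (\<Oplus>p\<in>Pair x ` Y. f p) \<oplus> (\<Oplus>p\<in>X \<times> Y. f p)"
    using insert assms(2) by (simp only:) (intro finsum_Un_disjoint; force)
  also have "(\<Oplus>p\<in>Pair x ` Y. f p) = (\<Oplus>b\<in>Y. f (x, b))"
    using insert by (intro finsum_reindex) (auto simp: inj_on_def)
  also have "(\<Oplus>p\<in>X \<times> Y. f p) = (\<Oplus>a\<in>X. \<Oplus>b\<in>Y. f (a, b))"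
    using insert by simp
  also have "(\<Oplus>b\<in>Y. f (x, b)) \<oplus> \<dots> = (\<Oplus>a\<in>insert x X. \<Oplus>b\<in>Y. f (a, b))"
    using insert by (subst finsum_insert) (auto intro!: finsum_closed)
  finally show ?case .
qed simp

text \<open>The square of indices splits into the pairs i < j, their mirror images and the diagonal.
  Symmetry is asked only off the diagonal because it will come from orthogonality of distinct basis
  vectors.\<close>

lemma finsum_symmetric:
  assumes closed: "\<And>i j. f i j \<in> carrier G" and sym: "\<And>i j. i \<in> {1..n} \<Longrightarrow> j \<in> {1..n} \<Longrightarrow> i \<noteq> j \<Longrightarrow> f j i = f i j"
    and diag: "\<And>i. f i i = \<zero>"
  shows "(\<Oplus>i\<in>{1..n}. \<Oplus>j\<in>{1..n}. f i j) =
    (\<Oplus>p\<in>index_pairs n. case p of (i, j) \<Rightarrow> f i j) \<oplus> (\<Oplus>p\<in>index_pairs n. case p of (i, j) \<Rightarrow> f i j)"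
proof -
  let ?P = "index_pairs n" and ?D = "(\<lambda>i. (i, i)) ` {1..n}" and ?f = "\<lambda>(i, j). f i j"
  have fin: "finite ?P"
    by (rule finite_subset[of _ "{1..n} \<times> {1..n}"]) (auto simp: index_pairs_def)
  have decomp: "{1..n} \<times> {1..n} = (?P \<union> prod.swap ` ?P) \<union> ?D"
    by (auto simp: index_pairs_def image_iff)
  have "(\<Oplus>i\<in>{1..n}. \<Oplus>j\<in>{1..n}. f i j) = (\<Oplus>p\<in>{1..n} \<times> {1..n}. ?f p)"
    by (subst finsum_Times) (auto simp: closed)
  also have "\<dots> = (\<Oplus>p\<in>?P \<union> prod.swap ` ?P. ?f p) \<oplus> (\<Oplus>p\<in>?D. ?f p)"
    unfolding decomp using fin
    by (intro finsum_Un_disjoint) (auto simp: closed index_pairs_def)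
  also have "(\<Oplus>p\<in>?D. ?f p) = \<zero>"
    by (rule add.finprod_one_eqI) (auto simp: diag)
  also have "(\<Oplus>p\<in>?P \<union> prod.swap ` ?P. ?f p) = (\<Oplus>p\<in>?P. ?f p) \<oplus> (\<Oplus>p\<in>prod.swap ` ?P. ?f p)"
    using fin by (intro finsum_Un_disjoint) (auto simp: closed index_pairs_def)
  also have "(\<Oplus>p\<in>prod.swap ` ?P. ?f p) = (\<Oplus>p\<in>?P. ?f (prod.swap p))"
    by (intro finsum_reindex) (auto simp: closed)
  also have "\<dots> = (\<Oplus>p\<in>?P. ?f p)"
    by (intro finsum_cong') (auto simp: closed index_pairs_def intro!: sym)
  finally show ?thesis
    by (simp add: closed finsum_closed split_def)
qed

end

section \<open>The Dirac element as half a double trace, and its conjugation by the Pin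
  cover\<close>

context cherednik_data
begin

abbreviation P where "P \<equiv> tensor_product AMA clifford"

sublocale P: associative_algebra P
  by (rule associative_tensor_product[OF AMA.associative_algebra_axioms associative_clifford])

abbreviation \<gamma> where "\<gamma> u \<equiv> clifford_of_real (clifford_vec u)"

text \<open>Four separate arguments allow the contraction of u with u' and that of v with v' to be
  changed independently of each other.\<close>

definition \<Phi> where "\<Phi> u v u' v' = pure_tensor AMA clifford (M u v) (\<gamma> u' \<otimes>\<^bsub>clifford\<^esub> \<gamma> v')"

lemmas tensor_simps =
  pure_tensor_closed[OF AMA.associative_algebra_axioms associative_clifford]
  pure_tensor_add_left[OF AMA.associative_algebra_axioms associative_clifford, unfolded AMA_simps]
  pure_tensor_add_right[OF AMA.associative_algebra_axioms associative_clifford]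
  pure_tensor_smult_left[OF AMA.associative_algebra_axioms associative_clifford, unfolded AMA_simps]
  pure_tensor_smult_right[OF AMA.associative_algebra_axioms associative_clifford]
  pure_tensor_mult[OF AMA.associative_algebra_axioms associative_clifford, unfolded AMA_simps]
  pure_tensor_one[OF AMA.associative_algebra_axioms associative_clifford, unfolded AMA_simps]

lemma \<gamma>_closed [simp]: "\<gamma> u \<in> carrier clifford"
  by (simp add: clifford_of_real_simps)

lemma \<gamma>_add: "\<gamma> (u + v) = \<gamma> u \<oplus>\<^bsub>clifford\<^esub> \<gamma> v"
  by (simp add: clifford_vec_add clifford_of_real_simps)

lemma \<gamma>_scale: "\<gamma> (r *\<^sub>R u) = complex_of_real r \<odot>\<^bsub>clifford\<^esub> \<gamma> u"
  by (simp add: clifford_vec_scaleR clifford_of_real_simps)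

text \<open>The sign is written as the scalar -1 because scalars can be pulled out of a
  \<open>pure_tensor\<close> by its bilinearity rules.\<close>

lemma \<gamma>_anticommute:
  assumes "u \<bullet> v = 0"
  shows "\<gamma> v \<otimes>\<^bsub>clifford\<^esub> \<gamma> u = (- 1) \<odot>\<^bsub>clifford\<^esub> (\<gamma> u \<otimes>\<^bsub>clifford\<^esub> \<gamma> v)"
proof -
  have "clifford_vec v \<otimes>\<^bsub>real_clifford\<^esub> clifford_vec u \<oplus>\<^bsub>real_clifford\<^esub>
      clifford_vec u \<otimes>\<^bsub>real_clifford\<^esub> clifford_vec v = \<zero>\<^bsub>real_clifford\<^esub>"
    using clifford_vec_relation[of v u] assms by (simp add: inner_commute)
  then have "\<ominus>\<^bsub>real_clifford\<^esub> (clifford_vec u \<otimes>\<^bsub>real_clifford\<^esub> clifford_vec v) =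
      clifford_vec v \<otimes>\<^bsub>real_clifford\<^esub> clifford_vec u"
    by (intro RC.minus_equality) simp_all
  then have "clifford_vec v \<otimes>\<^bsub>real_clifford\<^esub> clifford_vec u =
      (- 1) \<odot>\<^bsub>real_clifford\<^esub> (clifford_vec u \<otimes>\<^bsub>real_clifford\<^esub> clifford_vec v)"
    by (simp add: RC.minus_eq_smult)
  from arg_cong[OF this, of clifford_of_real] show ?thesis
    by (simp add: clifford_of_real_simps)
qed

lemma \<Phi>_closed [simp]: "\<Phi> u v u' v' \<in> carrier P"
  by (simp add: \<Phi>_def tensor_simps)

lemma \<Phi>_add:
  "\<Phi> (u + w) v u' v' = \<Phi> u v u' v' \<oplus>\<^bsub>P\<^esub> \<Phi> w v u' v'"
  "\<Phi> u (v + w) u' v' = \<Phi> u v u' v' \<oplus>\<^bsub>P\<^esub> \<Phi> u w u' v'"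
  "\<Phi> u v (u' + w) v' = \<Phi> u v u' v' \<oplus>\<^bsub>P\<^esub> \<Phi> u v w v'"
  "\<Phi> u v u' (v' + w) = \<Phi> u v u' v' \<oplus>\<^bsub>P\<^esub> \<Phi> u v u' w"
  by (simp_all add: \<Phi>_def M_add \<gamma>_add CC.l_distr CC.r_distr tensor_simps)

lemma \<Phi>_scale:
  "\<Phi> (r *\<^sub>R u) v u' v' = complex_of_real r \<odot>\<^bsub>P\<^esub> \<Phi> u v u' v'"
  "\<Phi> u (r *\<^sub>R v) u' v' = complex_of_real r \<odot>\<^bsub>P\<^esub> \<Phi> u v u' v'"
  "\<Phi> u v (r *\<^sub>R u') v' = complex_of_real r \<odot>\<^bsub>P\<^esub> \<Phi> u v u' v'"
  "\<Phi> u v u' (r *\<^sub>R v') = complex_of_real r \<odot>\<^bsub>P\<^esub> \<Phi> u v u' v'"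
  by (simp_all add: \<Phi>_def M_scale \<gamma>_scale CC.smult_mult_left CC.smult_mult_right tensor_simps)

text \<open>M(u, u) vanishes, so it equals 0 times itself, and the scalar 0 can be pulled out of the
  tensor.\<close>

lemma \<Phi>_diag: "\<Phi> u u u' v' = \<zero>\<^bsub>P\<^esub>"
proof -
  have "\<Phi> u u u' v' = pure_tensor AMA clifford (0 \<odot>\<^bsub>H\<^esub> M u u) (\<gamma> u' \<otimes>\<^bsub>clifford\<^esub> \<gamma> v')"
    by (simp add: \<Phi>_def M_self)
  also have "\<dots> = 0 \<odot>\<^bsub>P\<^esub> \<Phi> u u u' v'"
    by (simp only: tensor_simps(4) AMA_closed CC.m_closed \<gamma>_closed \<Phi>_def)
  finally show ?thesis
    by simp
qed

text \<open>Both tensor factors change sign: the angular momentum always, the Clifford product by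
  orthogonality. The two scalars -1 multiply to 1.\<close>

lemma \<Phi>_swap:
  assumes "u \<bullet> v = 0"
  shows "\<Phi> v u v u = \<Phi> u v u v"
proof -
  have "M v u = (- 1) \<odot>\<^bsub>H\<^esub> M u v"
    using M_swap[of v u] by (simp add: H.minus_eq_smult)
  then have "\<Phi> v u v u = (- 1) \<odot>\<^bsub>P\<^esub> ((- 1) \<odot>\<^bsub>P\<^esub> \<Phi> u v u v)"
    unfolding \<Phi>_def \<gamma>_anticommute[OF assms]
    by (simp only: tensor_simps(4,5) AMA_closed CC.m_closed CC.smult_closed \<gamma>_closed)
  then show ?thesis
    by (simp flip: P.smult_assoc)
qed

definition D where "D y = (\<Oplus>\<^bsub>P\<^esub>p\<in>index_pairs DIM('a). case p of (i, j) \<Rightarrow> \<Phi> (y i) (y j) (y i) (y j))"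

lemma D_closed [simp]: "D y \<in> carrier P"
  unfolding D_def by (rule P.finsum_closed) auto

lemma D_double:
  assumes "orthonormal_basis y"
  shows "D y \<oplus>\<^bsub>P\<^esub> D y = (\<Oplus>\<^bsub>P\<^esub>i\<in>{1..DIM('a)}. \<Oplus>\<^bsub>P\<^esub>j\<in>{1..DIM('a)}. \<Phi> (y i) (y j) (y i) (y j))"
  unfolding D_def using assms
  by (intro P.finsum_symmetric[symmetric]) (auto simp: \<Phi>_diag orthonormal_basis_def intro!: \<Phi>_swap)

lemma D_independent:
  assumes y: "orthonormal_basis y" and y': "orthonormal_basis y'"
  shows "D y = D y'"
proof -
  let ?I = "{1..DIM('a)}"
  \<comment> \<open>The bases are exchanged one contraction at a time, through a mixed sum with y in
    the first contraction and y' in the second. Each exchange concerns the inner sum, hence the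
    interchange of summations in between.\<close>
  have "(\<Oplus>\<^bsub>P\<^esub>i\<in>?I. \<Oplus>\<^bsub>P\<^esub>j\<in>?I. \<Phi> (y i) (y j) (y i) (y j)) =
      (\<Oplus>\<^bsub>P\<^esub>i\<in>?I. \<Oplus>\<^bsub>P\<^esub>j\<in>?I. \<Phi> (y i) (y' j) (y i) (y' j))"
    using P.orthonormal_trace_eq[OF y y', where F = "\<lambda>v v'. \<Phi> (y _) v (y _) v'"]
    by (simp add: \<Phi>_add \<Phi>_scale)
  also have "\<dots> = (\<Oplus>\<^bsub>P\<^esub>j\<in>?I. \<Oplus>\<^bsub>P\<^esub>i\<in>?I. \<Phi> (y i) (y' j) (y i) (y' j))"
    by (rule P.finsum_swap) simp_all
  also have "\<dots> = (\<Oplus>\<^bsub>P\<^esub>j\<in>?I. \<Oplus>\<^bsub>P\<^esub>i\<in>?I. \<Phi> (y' i) (y' j) (y' i) (y' j))"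
    using P.orthonormal_trace_eq[OF y y', where F = "\<lambda>u u'. \<Phi> u (y' _) u' (y' _)"]
    by (simp add: \<Phi>_add \<Phi>_scale)
  also have "\<dots> = (\<Oplus>\<^bsub>P\<^esub>i\<in>?I. \<Oplus>\<^bsub>P\<^esub>j\<in>?I. \<Phi> (y' i) (y' j) (y' i) (y' j))"
    by (rule P.finsum_swap) simp_all
  finally have double: "D y \<oplus>\<^bsub>P\<^esub> D y = D y' \<oplus>\<^bsub>P\<^esub> D y'"
    by (simp add: D_double y y')
  \<comment> \<open>Doubling is injective because the complex scalar 1/2 undoes it.\<close>
  have half: "(1 / 2) \<odot>\<^bsub>P\<^esub> (D z \<oplus>\<^bsub>P\<^esub> D z) = D z" for z
    using P.smult_l_distr[of "D z" "1 / 2" "1 / 2"] by (simp add: P.smult_r_distr)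
  show ?thesis
    using half[of y] unfolding double half by (rule sym)
qed

lemma ama_dirac_eq:
  assumes "orthonormal_basis y"
  shows "ama_dirac W Rp c y = D y"
  by (simp add: ama_dirac_def ama_clifford_def angular_momentum_algebra_eq[OF assms] D_def \<Phi>_def
      angular_momentum_eq)

definition \<rho> where "\<rho> \<eta> = pure_tensor AMA clifford (w_elem (pin_map \<eta>)) (clifford_of_real \<eta>)"

lemma pin_coverD:
  assumes "\<eta> \<in> pin_cover W"
  shows "pin_map \<eta> \<in> W" "\<eta> \<in> Pin" "\<eta> \<in> Units real_clifford" "\<eta> \<in> carrier real_clifford"
  using assms by (auto simp: pin_cover_def Pin_def)

lemma \<rho>_closed [simp]: "\<eta> \<in> pin_cover W \<Longrightarrow> \<rho> \<eta> \<in> carrier P"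
  by (simp add: \<rho>_def tensor_simps pin_coverD clifford_of_real_simps)

lemma ama_rho_single:
  assumes "orthonormal_basis y" "\<eta> \<in> pin_cover W"
  shows "ama_rho W Rp c y (Poly_Mapping.single \<eta> 1) = \<rho> \<eta>"
  using \<rho>_closed[OF assms(2)]
  by (simp add: ama_rho_def ama_clifford_def angular_momentum_algebra_eq[OF assms(1)] \<rho>_def)

text \<open>The inverse is formed factorwise, from the inverse of p(\<eta>) in W and the inverse of
  \<eta> in the Clifford algebra.\<close>

lemma \<rho>_Units:
  assumes \<eta>: "\<eta> \<in> pin_cover W"
  shows "\<rho> \<eta> \<in> Units P"
proof -
  note \<eta>D = pin_coverD[OF \<eta>]
  obtain w' where w': "w' \<in> W" "w' \<circ> pin_map \<eta> = id" "pin_map \<eta> \<circ> w' = id"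
    using inv_W[OF \<eta>D(1)] by blast
  let ?\<eta>' = "inv\<^bsub>real_clifford\<^esub> \<eta>"
  let ?\<sigma> = "pure_tensor AMA clifford (w_elem w') (clifford_of_real ?\<eta>')"
  have \<eta>': "?\<eta>' \<in> carrier real_clifford"
    using \<eta>D by simp
  have "w_elem w' \<otimes>\<^bsub>H\<^esub> w_elem (pin_map \<eta>) = \<one>\<^bsub>H\<^esub>" "w_elem (pin_map \<eta>) \<otimes>\<^bsub>H\<^esub> w_elem w' = \<one>\<^bsub>H\<^esub>"
    using w' \<eta>D by (simp_all add: w_elem_mult w_elem_id)
  moreover have "clifford_of_real ?\<eta>' \<otimes>\<^bsub>clifford\<^esub> clifford_of_real \<eta> = \<one>\<^bsub>clifford\<^esub>"
    "clifford_of_real \<eta> \<otimes>\<^bsub>clifford\<^esub> clifford_of_real ?\<eta>' = \<one>\<^bsub>clifford\<^esub>"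
    using \<eta>D \<eta>' by (simp_all add: clifford_of_real_simps(4) flip: clifford_of_real_simps(3))
  ultimately have "?\<sigma> \<otimes>\<^bsub>P\<^esub> \<rho> \<eta> = \<one>\<^bsub>P\<^esub>" "\<rho> \<eta> \<otimes>\<^bsub>P\<^esub> ?\<sigma> = \<one>\<^bsub>P\<^esub>" "?\<sigma> \<in> carrier P"
    using w' \<eta>D \<eta>' tensor_simps(7) by (simp_all add: \<rho>_def tensor_simps(1,6) clifford_of_real_simps(1))
  then show ?thesis
    using \<rho>_closed[OF \<eta>] unfolding Units_def by blast
qed

text \<open>The two tensor factors are treated separately, by \<open>w_elem_M\<close> and by
  \<open>pin_conj\<close>, and both move their vectors by the same w.\<close>

lemma \<rho>_\<Phi>:
  assumes \<eta>: "\<eta> \<in> pin_cover W"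
  defines "w \<equiv> pin_map \<eta>"
  shows "\<rho> \<eta> \<otimes>\<^bsub>P\<^esub> \<Phi> u v u' v' = \<Phi> (w u) (w v) (w u') (w v') \<otimes>\<^bsub>P\<^esub> \<rho> \<eta>"
proof -
  note \<eta>D = pin_coverD[OF \<eta>]
  have "clifford_of_real \<eta> \<otimes>\<^bsub>clifford\<^esub> (\<gamma> u' \<otimes>\<^bsub>clifford\<^esub> \<gamma> v') =
      (\<gamma> (w u') \<otimes>\<^bsub>clifford\<^esub> \<gamma> (w v')) \<otimes>\<^bsub>clifford\<^esub> clifford_of_real \<eta>"
    using pin_conj[OF \<eta>D(2), of u' v'] \<eta>D(4)
    by (simp add: w_def flip: clifford_of_real_simps(3))
  then show ?thesis
    using w_elem_M[OF \<eta>D(1), of u v] \<eta>D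
    by (simp add: \<rho>_def \<Phi>_def tensor_simps(6) clifford_of_real_simps(1) w_def)
qed

lemma \<rho>_D:
  assumes y: "orthonormal_basis y" and \<eta>: "\<eta> \<in> pin_cover W"
  shows "\<rho> \<eta> \<otimes>\<^bsub>P\<^esub> D y = D y \<otimes>\<^bsub>P\<^esub> \<rho> \<eta>"
proof -
  let ?w = "pin_map \<eta>"
  have fin: "finite (index_pairs DIM('a))"
    by (rule finite_subset[of _ "{1..DIM('a)} \<times> {1..DIM('a)}"]) (auto simp: index_pairs_def)
  have "\<rho> \<eta> \<otimes>\<^bsub>P\<^esub> D y =
      (\<Oplus>\<^bsub>P\<^esub>p\<in>index_pairs DIM('a). \<rho> \<eta> \<otimes>\<^bsub>P\<^esub> (case p of (i, j) \<Rightarrow> \<Phi> (y i) (y j) (y i) (y j)))"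
    unfolding D_def using \<rho>_closed[OF \<eta>] fin by (intro P.finsum_rdistr) auto
  also have "\<dots> = (\<Oplus>\<^bsub>P\<^esub>p\<in>index_pairs DIM('a).
      (case p of (i, j) \<Rightarrow> \<Phi> (?w (y i)) (?w (y j)) (?w (y i)) (?w (y j))) \<otimes>\<^bsub>P\<^esub> \<rho> \<eta>)"
    using \<eta> by (intro P.finsum_cong') (auto simp: \<rho>_\<Phi>)
  also have "\<dots> = D (\<lambda>i. ?w (y i)) \<otimes>\<^bsub>P\<^esub> \<rho> \<eta>"
    unfolding D_def using \<rho>_closed[OF \<eta>] fin by (intro P.finsum_ldistr[symmetric]) auto
  also have "D (\<lambda>i. ?w (y i)) = D y"
    by (rule D_independent[OF orthonormal_basis_orthogonal_image[OF y
            orthogonal_W[OF pin_coverD(1)[OF \<eta>]]] y])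
  finally show ?thesis .
qed

lemma \<rho>_conj_D:
  assumes "orthonormal_basis y" "\<eta> \<in> pin_cover W"
  shows "\<rho> \<eta> \<otimes>\<^bsub>P\<^esub> D y \<otimes>\<^bsub>P\<^esub> inv\<^bsub>P\<^esub> \<rho> \<eta> = D y"
  using \<rho>_Units[OF assms(2)] by (simp add: \<rho>_D[OF assms] P.m_assoc assms)

end

text \<open>Equality of the two algebras belongs to the claim, since it puts both Dirac elements
  into the same ring. Membership in \<open>Units\<close> is stated because \<open>inv\<close>
  denotes a genuine inverse only for units; the conjugating element is \<rho> at the basis element
  of the group algebra that represents \<eta>.\<close>

theorem proposition3p2:
  fixes W :: "('a::euclidean_space \<Rightarrow> 'a) set"
    and R Rp :: "'a dual set"
    and c :: "'a dual \<Rightarrow> complex"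
  assumes "reflection_group_with_roots W R"
    and "positive_system R Rp"
    and "invariant_parameter W Rp c"
  shows "(\<forall>y y'. orthonormal_basis y \<longrightarrow> orthonormal_basis y' \<longrightarrow>
            angular_momentum_algebra W Rp c y = angular_momentum_algebra W Rp c y' \<and>
            ama_dirac W Rp c y = ama_dirac W Rp c y') \<and>
         (\<forall>y. orthonormal_basis y \<longrightarrow>
            ama_dirac W Rp c y \<in> carrier (ama_clifford W Rp c y) \<and>
            (\<forall>\<eta>\<in>pin_cover W.
               ama_rho W Rp c y (Poly_Mapping.single \<eta> 1) \<in> Units (ama_clifford W Rp c y) \<and>
               ama_rho W Rp c y (Poly_Mapping.single \<eta> 1)
                 \<otimes>\<^bsub>ama_clifford W Rp c y\<^esub> ama_dirac W Rp c y
                 \<otimes>\<^bsub>ama_clifford W Rp c y\<^esub>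
                   inv\<^bsub>ama_clifford W Rp c y\<^esub> ama_rho W Rp c y (Poly_Mapping.single \<eta> 1)
               = ama_dirac W Rp c y))"
proof -
  interpret cherednik_data W R Rp c
    by unfold_locales fact
  have P: "ama_clifford W Rp c y = P" if "orthonormal_basis y" for y
    using that by (simp add: ama_clifford_def angular_momentum_algebra_eq)
  have "ama_dirac W Rp c y = ama_dirac W Rp c y'"
    if "orthonormal_basis y" "orthonormal_basis y'" for y y'
    using D_independent[OF that] that by (simp only: ama_dirac_eq)
  moreover have "angular_momentum_algebra W Rp c y = angular_momentum_algebra W Rp c y'"
    if "orthonormal_basis y" "orthonormal_basis y'" for y y'
    using that by (simp only: angular_momentum_algebra_eq)
  moreover have "ama_dirac W Rp c y \<in> carrier (ama_clifford W Rp c y)" if "orthonormal_basis y" for y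
    using that by (simp only: P ama_dirac_eq D_closed)
  moreover have "ama_rho W Rp c y (Poly_Mapping.single \<eta> 1) \<in> Units (ama_clifford W Rp c y) \<and>
      ama_rho W Rp c y (Poly_Mapping.single \<eta> 1)
        \<otimes>\<^bsub>ama_clifford W Rp c y\<^esub> ama_dirac W Rp c y
        \<otimes>\<^bsub>ama_clifford W Rp c y\<^esub>
          inv\<^bsub>ama_clifford W Rp c y\<^esub> ama_rho W Rp c y (Poly_Mapping.single \<eta> 1)
      = ama_dirac W Rp c y" if "orthonormal_basis y" "\<eta> \<in> pin_cover W" for y \<eta>
    using that by (simp only: P ama_dirac_eq ama_rho_single \<rho>_Units \<rho>_conj_D)
  ultimately show ?thesis
    by blast
qed

end
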